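(* Let $L$ satisfy the structured-inverse hypothesis with constant $\eta\in(0,1]$ (see context) on a $p$-dimensional subspace $\mathcal U\subseteq\mathbb{R}^n$, and let $Z_\star\in\mathbb{R}^{n\times\ell}$ be arbitrary. If either $k\ge p$, or $k<p$ and $$k-\ell>(1-\eta)\bigl(\min\{\ell,p-k\}+2\bigr),$$ then every second-order critical point $Z\in\mathbb{R}^{n\times k}$ of the problem $\min_{Z\in\mathbb{R}^{n\times k}}g(Z;Z_\star)$ is globally optimal, i.e. a global minimizer of $g(\cdot;Z_\star)$. In particular, whenever $k\ge 2(\ell+1)$, every second-order critical point of this problem is a global minimizer.
   Context: Let $n,k,\ell\ge1$ be integers. Matrix spaces carry the Frobenius inner product $\langle X,Y\rangle=\mathrm{Tr}(X^\top Y)$. $\mathrm{Sym}(n)$ is the space of real symmetric $n\times n$ matrices. Let $\mathcal U\subseteq\mathbb{R}^n$ be a linear subspace of dimension $p$ with orthogonal projector $P_{\mathcal U}$, and $\mathrm{Sym}(\mathcal U)=\{Y\in\mathrm{Sym}(n):Y=P_{\mathcal U}YP_{\mathcal U}\}$. Let $L:\mathrm{Sym}(\mathcal U)\to\mathrm{Sym}(\mathcal U)$ be linear, self-adjoint and positive definite, extended to $\mathrm{Sym}(n)$ by $L(X):=L(P_{\mathcal U}XP_{\mathcal U})$. Structured-inverse hypothesis: there are vectors $a_1,\ldots,a_N\in\mathcal U$ ($N=0$ allowed) and a constant $\eta\in(0,1]$ such that (F1) $\sum_{i=1}^N a_ia_i^\top\preceq P_{\mathcal U}$; (F2) $\|a_i\|^2\le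 1-\eta$ for all $i$; (F3) $L^{-1}=I-\Gamma$ on $\mathrm{Sym}(\mathcal U)$, where $\Gamma(X)=\sum_{i=1}^N a_ia_i^\top\,(a_i^\top Xa_i)$. Objective: for $Z\in\mathbb{R}^{n\times k}$ and $Z_\star\in\mathbb{R}^{n\times\ell}$, with $Y=ZZ^\top$ and $Y_\star=Z_\star Z_\star^\top$, $g(Z;Z_\star)=\langle Y-Y_\star,L(Y-Y_\star)\rangle$. Criticality: let $S=L(Y_\star-Y)$. $Z$ is first-order critical if $SZ=0$. $Z$ is second-order critical if in addition $0\le-\langle\dot Z\dot Z^\top,S\rangle+\frac12\langle\dot Y,L\dot Y\rangle$ for all $\dot Z\in\mathbb{R}^{n\times k}$, where $\dot Y=Z\dot Z^\top+\dot ZZ^\top$. (These are equivalent to vanishing gradient and positive semidefinite Hessian of $g(\cdot;Z_\star)$.) *)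

theory Defs
  imports "HOL-Analysis.Analysis"
begin

section \<open>Matrices\<close>

text \<open>An \<open>n \<times> k\<close> real matrix has type \<^typ>\<open>real ^ 'k ^ 'n\<close>, so that
  \<open>n, k, \<ell> \<ge> 1\<close> holds automatically.\<close>

definition frob :: "real ^ 'k ^ 'n \<Rightarrow> real ^ 'k ^ 'n \<Rightarrow> real" where
  "frob X Y = trace (transpose X ** Y)"

definition outer :: "real ^ 'n \<Rightarrow> real ^ 'n ^ 'n" where
  "outer a = (\<chi> i j. a $ i * a $ j)"

definition sym_mats :: "(real ^ 'n ^ 'n) set" where
  "sym_mats = {Y. transpose Y = Y}"

definition psd :: "real ^ 'n ^ 'n \<Rightarrow> bool" where
  "psd A \<longleftrightarrow> A \<in> sym_mats \<and> (\<forall>x. 0 \<le> x \<bullet> (A *v x))"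

definition loewner_le :: "real ^ 'n ^ 'n \<Rightarrow> real ^ 'n ^ 'n \<Rightarrow> bool" (infix "\<preceq>" 50) where
  "A \<preceq> B \<longleftrightarrow> psd (B - A)"

definition orth_proj :: "(real ^ 'n) set \<Rightarrow> real ^ 'n ^ 'n" where
  "orth_proj U = (THE P. transpose P = P \<and> P ** P = P \<and> range ((*v) P) = U)"

definition sym_mats_on :: "(real ^ 'n) set \<Rightarrow> (real ^ 'n ^ 'n) set" where
  "sym_mats_on U = {Y \<in> sym_mats. Y = orth_proj U ** Y ** orth_proj U}"

lemma frob_eq_inner: "frob X Y = X \<bullet> Y"
proof -
  have "frob X Y = (\<Sum>j\<in>UNIV. \<Sum>i\<in>UNIV. X $ i $ j * Y $ i $ j)"
    by (simp add: frob_def trace_def transpose_def matrix_matrix_mult_def)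
  also have "\<dots> = (\<Sum>i\<in>UNIV. \<Sum>j\<in>UNIV. X $ i $ j * Y $ i $ j)"
    by (rule sum.swap)
  finally show ?thesis by (simp add: inner_vec_def)
qed

lemma outer_mult_vec: "outer a *v x = (a \<bullet> x) *\<^sub>R a"
  by (simp add: outer_def matrix_vector_mult_def inner_vec_def vec_eq_iff
      sum_distrib_left sum_distrib_right mult_ac)

lemma orth_proj_unique:
  fixes P Q :: "real ^ 'n ^ 'n"
  assumes "transpose P = P" "P ** P = P" "transpose Q = Q" "Q ** Q = Q"
    and "range ((*v) P) = range ((*v) Q)"
  shows "P = Q"
proof -
  have absorb: "A ** B = B" if AA: "A ** A = A" and rng: "range ((*v) B) = range ((*v) A)"
    for A B :: "real ^ 'n ^ 'n"
  proof (subst matrix_eq, rule allI)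
    fix x
    obtain y where "B *v x = A *v y" using rng by (metis rangeE rangeI)
    then show "(A ** B) *v x = B *v x"
      by (metis AA matrix_vector_mul_assoc)
  qed
  have "P = transpose (Q ** P)" using absorb[of Q P] assms by simp
  also have "\<dots> = P ** Q" using assms by (simp add: matrix_transpose_mul)
  also have "\<dots> = Q" using absorb[of P Q] assms by simp
  finally show ?thesis .
qed

lemma orth_proj_exists:
  fixes U :: "(real ^ 'n) set"
  assumes "subspace U"
  shows "\<exists>P. transpose P = P \<and> P ** P = P \<and> range ((*v) P) = U"
proof -
  obtain B where B: "B \<subseteq> U" "pairwise orthogonal B" "\<And>x. x \<in> B \<Longrightarrow> norm x = 1"
      "independent B" "span B = U"
    using orthonormal_basis_subspace[OF assms] by metis
  have fin: "finite B" using B(4) independent_imp_finite by blast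
  define P where "P = (\<Sum>b\<in>B. outer b)"
  have Pv: "P *v x = (\<Sum>b\<in>B. (b \<bullet> x) *\<^sub>R b)" for x
  proof -
    have "(\<Sum>b\<in>C. outer b) *v x = (\<Sum>b\<in>C. (b \<bullet> x) *\<^sub>R b)" if "finite C" for C
      using that by (induction C) (simp_all add: matrix_vector_mult_add_rdistrib outer_mult_vec)
    then show ?thesis using fin P_def by simp
  qed
  have in_U: "P *v x \<in> U" for x
    unfolding Pv using B assms by (auto intro!: subspace_sum subspace_scale)
  have fixB: "P *v c = c" if "c \<in> B" for c
  proof -
    have "(\<Sum>b\<in>B. (b \<bullet> c) *\<^sub>R b) = (\<Sum>b\<in>B. if b = c then c else 0)"
      using B that by (intro sum.cong) (auto simp: pairwise_def orthogonal_def norm_eq_1)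
    then show ?thesis using fin that by (simp add: Pv)
  qed
  have fixU: "P *v u = u" if "u \<in> U" for u
  proof -
    have "u \<in> span B" using that B by simp
    then show ?thesis
    proof (induction rule: span_induct_alt)
      case base then show ?case by simp
    next
      case (step c x y)
      then show ?case
        by (simp add: matrix_vector_right_distrib fixB matrix_vector_mult_scaleR)
    qed
  qed
  have "transpose P = P"
    by (simp add: P_def transpose_def vec_eq_iff outer_def mult.commute)
  moreover have "P ** P = P"
    by (subst matrix_eq) (simp flip: matrix_vector_mul_assoc add: fixU in_U)
  moreover have "range ((*v) P) = U" using in_U fixU by (metis image_subset_iff rangeI subsetI subset_antisym)
  ultimately show ?thesis by blast
qed

lemma orth_proj:
  assumes "subspace U"
  shows "transpose (orth_proj U) = orth_proj U"
    and "orth_proj U ** orth_proj U = orth_proj U"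
    and "range ((*v) (orth_proj U)) = U"
proof -
  have "\<exists>!P. transpose P = P \<and> P ** P = P \<and> range ((*v) P) = U"
    using orth_proj_exists[OF assms] orth_proj_unique by metis
  from theI'[OF this]
  show "transpose (orth_proj U) = orth_proj U"
    and "orth_proj U ** orth_proj U = orth_proj U"
    and "range ((*v) (orth_proj U)) = U"
    unfolding orth_proj_def by auto
qed

section \<open>The operator and its structured inverse\<close>

text \<open>An operator on \<open>Sym(U)\<close> is a function on all matrices of which only the values on
  \<^term>\<open>sym_mats_on U\<close> are constrained; \<open>extend_op\<close> below looks at no other values.\<close>

definition linear_spd_on ::
    "(real ^ 'n) set \<Rightarrow> (real ^ 'n ^ 'n \<Rightarrow> real ^ 'n ^ 'n) \<Rightarrow> bool" where
  "linear_spd_on U L \<longleftrightarrow>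
     (\<forall>X\<in>sym_mats_on U. L X \<in> sym_mats_on U) \<and>
     (\<forall>X\<in>sym_mats_on U. \<forall>Y\<in>sym_mats_on U. L (X + Y) = L X + L Y) \<and>
     (\<forall>c. \<forall>X\<in>sym_mats_on U. L (c *\<^sub>R X) = c *\<^sub>R L X) \<and>
     (\<forall>X\<in>sym_mats_on U. \<forall>Y\<in>sym_mats_on U. frob X (L Y) = frob (L X) Y) \<and>
     (\<forall>X\<in>sym_mats_on U. X \<noteq> 0 \<longrightarrow> 0 < frob X (L X))"

lemma linear_spd_on_bij:
  fixes U :: "(real ^ 'n) set"
  assumes U: "subspace U" and L: "linear_spd_on U L"
  shows "bij_betw L (sym_mats_on U) (sym_mats_on U)"
proof -
  define P where "P = orth_proj U"
  note P = orth_proj(1,2)[OF U, folded P_def]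
  have mem: "X \<in> sym_mats_on U \<longleftrightarrow> transpose X = X \<and> X = P ** X ** P" for X
    by (simp add: sym_mats_on_def sym_mats_def P_def)
  have lin: "linear (\<lambda>X. P ** X ** P)"
    by (rule linearI)
      (simp_all add: vec_eq_iff matrix_matrix_mult_def sum_distrib_left sum_distrib_right
        sum.distrib algebra_simps)
  have tr_add: "transpose (X + Y) = transpose X + transpose Y" for X Y :: "real ^ 'n ^ 'n"
    by (simp add: transpose_def vec_eq_iff)
  have tr_scale: "transpose (c *\<^sub>R X) = c *\<^sub>R transpose X" for c and X :: "real ^ 'n ^ 'n"
    by (simp add: transpose_def vec_eq_iff)
  have sub: "subspace (sym_mats_on U)"
    unfolding subspace_def using linear_add[OF lin] linear_scale[OF lin] linear_0[OF lin]
    by (auto simp: mem tr_add tr_scale) (simp add: transpose_def vec_eq_iff)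
  define R where "R = (\<lambda>X. (1/2) *\<^sub>R (P ** X ** P + transpose (P ** X ** P)))"
  have linR: "linear R"
    unfolding R_def
    by (rule linearI) (simp_all add: linear_add[OF lin] linear_scale[OF lin] tr_add tr_scale algebra_simps)
  have R_mem: "R X \<in> sym_mats_on U" for X
  proof -
    have "P ** (P ** X ** P) ** P = P ** X ** P" for X
      by (metis P(2) matrix_mul_assoc)
    moreover have "transpose (P ** X ** P) = P ** transpose X ** P" for X
      by (simp add: matrix_transpose_mul P matrix_mul_assoc)
    ultimately show ?thesis
      unfolding mem R_def linear_scale[OF lin] linear_add[OF lin]
      by (simp add: tr_add tr_scale add.commute)
  qed
  have R_id: "R X = X" if "X \<in> sym_mats_on U" for X
    using that unfolding mem R_def by (metis scaleR_half_double)
  define M where "M = L \<circ> R"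
  have linM: "linear M"
    using L R_mem unfolding M_def linear_spd_on_def
    by (intro linearI) (simp_all add: linear_add[OF linR] linear_scale[OF linR])
  have M_eq: "M X = L X" if "X \<in> sym_mats_on U" for X
    using R_id that by (simp add: M_def)
  have "X = 0" if "X \<in> sym_mats_on U" "M X = 0" for X
    using L that M_eq unfolding linear_spd_on_def by (metis frob_eq_inner inner_zero_right less_irrefl)
  then have inj: "inj_on M (sym_mats_on U)"
    using linear_injective_on_subspace_0[OF linM sub] by blast
  have "M ` sym_mats_on U = sym_mats_on U"
  proof (rule subspace_dim_equal)
    show "subspace (M ` sym_mats_on U)" using linear_subspace_image[OF linM sub] .
    show "M ` sym_mats_on U \<subseteq> sym_mats_on U" using L M_eq unfolding linear_spd_on_def by auto
    show "dim (M ` sym_mats_on U) \<ge> dim (sym_mats_on U)"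
      using dim_image_eq[OF linM, of "sym_mats_on U"] inj sub by (metis span_eq_iff order_refl)
  qed (rule sub)
  then have "bij_betw M (sym_mats_on U) (sym_mats_on U)" using inj by (simp add: bij_betw_def)
  then show ?thesis using M_eq by (simp cong: bij_betw_cong)
qed

definition extend_op ::
    "(real ^ 'n) set \<Rightarrow> (real ^ 'n ^ 'n \<Rightarrow> real ^ 'n ^ 'n) \<Rightarrow> real ^ 'n ^ 'n \<Rightarrow> real ^ 'n ^ 'n" where
  "extend_op U L X = L (orth_proj U ** X ** orth_proj U)"

definition Gamma_op :: "nat \<Rightarrow> (nat \<Rightarrow> real ^ 'n) \<Rightarrow> real ^ 'n ^ 'n \<Rightarrow> real ^ 'n ^ 'n" where
  "Gamma_op N a X = (\<Sum>i=1..N. (a i \<bullet> (X *v a i)) *\<^sub>R outer (a i))"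

text \<open>By \<open>linear_spd_on_bij\<close>, \<open>L\<close> is a bijection of \<open>Sym(U)\<close>, so \<^const>\<open>inv_into\<close> is its inverse there.\<close>

definition structured_inverse ::
    "(real ^ 'n) set \<Rightarrow> (real ^ 'n ^ 'n \<Rightarrow> real ^ 'n ^ 'n) \<Rightarrow> real \<Rightarrow> bool" where
  "structured_inverse U L \<eta> \<longleftrightarrow>
     0 < \<eta> \<and> \<eta> \<le> 1 \<and>
     (\<exists>N a. (\<forall>i\<in>{1..N}. a i \<in> U) \<and>
        (\<Sum>i=1..N. outer (a i)) \<preceq> orth_proj U \<and>
        (\<forall>i\<in>{1..N}. (norm (a i))\<^sup>2 \<le> 1 - \<eta>) \<and>
        (\<forall>X\<in>sym_mats_on U. inv_into (sym_mats_on U) L X = X - Gamma_op N a X))"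

section \<open>Objective and criticality\<close>

text \<open>Here \<open>L\<close> is the operator already extended to all of \<open>Sym(n)\<close>.\<close>

definition gram :: "real ^ 'k ^ 'n \<Rightarrow> real ^ 'n ^ 'n" where
  "gram Z = Z ** transpose Z"

definition objective ::
    "(real ^ 'n ^ 'n \<Rightarrow> real ^ 'n ^ 'n) \<Rightarrow> real ^ 'l ^ 'n \<Rightarrow> real ^ 'k ^ 'n \<Rightarrow> real" where
  "objective L Zs Z = frob (gram Z - gram Zs) (L (gram Z - gram Zs))"

definition first_order_critical ::
    "(real ^ 'n ^ 'n \<Rightarrow> real ^ 'n ^ 'n) \<Rightarrow> real ^ 'l ^ 'n \<Rightarrow> real ^ 'k ^ 'n \<Rightarrow> bool" where
  "first_order_critical L Zs Z \<longleftrightarrow> L (gram Zs - gram Z) ** Z = 0"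

definition second_order_critical ::
    "(real ^ 'n ^ 'n \<Rightarrow> real ^ 'n ^ 'n) \<Rightarrow> real ^ 'l ^ 'n \<Rightarrow> real ^ 'k ^ 'n \<Rightarrow> bool" where
  "second_order_critical L Zs Z \<longleftrightarrow>
     first_order_critical L Zs Z \<and>
     (\<forall>D :: real ^ 'k ^ 'n.
        let S = L (gram Zs - gram Z);
            Yd = Z ** transpose D + D ** transpose Z
        in 0 \<le> - frob (gram D) S + 1 / 2 * frob Yd (L Yd))"

definition global_minimizer :: "('a \<Rightarrow> real) \<Rightarrow> 'a \<Rightarrow> bool" where
  "global_minimizer f x \<longleftrightarrow> (\<forall>y. f x \<le> f y)"

end

theory Submission
  imports Defs
begin

text \<open>After projecting to \<open>U\<close>, write \<open>W = P Z\<close>, \<open>V = range W\<close>, \<open>Q\<close> for the projector onto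
  \<open>U \<inter> V\<^sup>\<bottom>\<close>, \<open>c\<^sub>i = Q a\<^sub>i\<close>, \<open>u\<^sub>j\<close> for the columns of \<open>Q Z\<^sub>\<star>\<close> and \<open>s\<^sub>i = a\<^sub>i\<^sup>T S a\<^sub>i\<close>. Since \<open>S W = 0\<close>,
  compressing \<open>Y\<^sub>\<star> - Y = S - \<Gamma> S\<close> by \<open>Q\<close> gives \<open>S = \<Sum> u\<^sub>j u\<^sub>j\<^sup>T + \<Sum> s\<^sub>i c\<^sub>i c\<^sub>i\<^sup>T\<close>, and as the last map is a
  contraction preserving positivity, \<open>S\<close> is positive semidefinite. The objective vanishes as soon
  as \<open>S = 0\<close>. If \<open>W\<close> has a kernel, or \<open>V = U\<close>, then \<open>S = 0\<close> follows quickly.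

  Otherwise let \<open>\<theta> = \<Sum> |u\<^sub>j|\<^sup>2\<close> and \<open>K = {x \<in> V. Y\<^sub>\<star> x = 0}\<close>, which has dimension at least \<open>k - \<ell>\<close>. For
  \<open>x \<in> K\<close> one has \<open>x\<^sup>T Y x = \<rho> x\<close> where \<open>\<rho> x = \<Sum> s\<^sub>i (a\<^sub>i \<bullet> x)\<^sup>2\<close>. Testing second-order criticality on
  directions whose velocity is \<open>L\<^sup>-\<^sup>1\<close> of a correction of \<open>x u\<^sub>j\<^sup>T + u\<^sub>j x\<^sup>T\<close>, and summing over
  \<open>j\<close>, gives \<open>\<theta> \<le> (r + 2) \<rho> x\<close> for unit \<open>x \<in> K\<close> with \<open>r = min \<ell> (p - k)\<close>. Summing over an orthonormal
  basis of \<open>K\<close> and using \<open>|a\<^sub>i|\<^sup>2 \<le> 1 - \<eta>\<close> yields \<open>(k - \<ell>) \<theta> \<le> (r + 2) (1 - \<eta>) \<theta>\<close>. Under the gap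
  assumption \<open>\<theta> = 0\<close>, and then \<open>S = 0\<close> by contraction.\<close>

section \<open>Rank-one sums and quadratic forms\<close>

lemma scaled_outer_mult_vec: "(t *\<^sub>R outer c) *v x = (t * (c \<bullet> x)) *\<^sub>R c"
  by (simp add: outer_def matrix_vector_mult_def inner_vec_def vec_eq_iff
      sum_distrib_left sum_distrib_right mult_ac)

lemma sum_matrix_vector_mult:
  "(\<Sum>i\<in>I. A i) *v x = (\<Sum>i\<in>I. A i *v x)"
  by (induction I rule: infinite_finite_induct) (simp_all add: matrix_vector_mult_add_rdistrib)

lemma quad_sum_outer:
  "x \<bullet> ((\<Sum>i\<in>I. t i *\<^sub>R outer (c i)) *v y) = (\<Sum>i\<in>I. t i * (c i \<bullet> x) * (c i \<bullet> y))"
  by (simp add: sum_matrix_vector_mult scaled_outer_mult_vec inner_sum_right inner_commute mult_ac)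

lemma inner_outer: "A \<bullet> outer c = c \<bullet> (A *v c)"
  by (simp add: outer_def matrix_vector_mult_def inner_vec_def sum_distrib_left mult_ac)

lemma transpose_outer [simp]: "transpose (outer a) = outer a"
  by (simp add: transpose_def outer_def mult.commute)

lemma transpose_plus: "transpose (X + Y) = transpose X + transpose Y"
  for X Y :: "real ^ 'm ^ 'n"
  by (simp add: transpose_def vec_eq_iff)

lemma transpose_minus: "transpose (X - Y) = transpose X - transpose Y"
  for X Y :: "real ^ 'm ^ 'n"
  by (simp add: transpose_def vec_eq_iff)

lemma transpose_sum: "transpose (\<Sum>i\<in>I. A i) = (\<Sum>i\<in>I. transpose (A i))"
  for A :: "'i \<Rightarrow> real ^ 'm ^ 'n"
  by (simp add: transpose_def vec_eq_iff)

lemma transpose_zero [simp]: "transpose (0 :: real ^ 'm ^ 'n) = 0"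
  by (simp add: transpose_def vec_eq_iff)

lemma transpose_gram [simp]: "transpose (gram Z) = gram Z"
  by (simp add: gram_def matrix_transpose_mul)

lemma inner_matrix_transpose:
  fixes A :: "real ^ 'm ^ 'n"
  shows "x \<bullet> (transpose A *v y) = (A *v x) \<bullet> y"
  by (metis dot_lmul_matrix inner_commute transpose_matrix_vector)

lemma linear_conj: "linear (\<lambda>X :: real ^ 'n ^ 'n. A ** X ** B)"
  by (rule linearI)
    (simp_all add: vec_eq_iff matrix_matrix_mult_def sum_distrib_left sum_distrib_right
      sum.distrib algebra_simps)

lemma inner_symmetric_matrix:
  fixes A :: "real ^ 'n ^ 'n"
  assumes "transpose A = A"
  shows "x \<bullet> (A *v y) = (A *v x) \<bullet> y"
  by (metis assms inner_matrix_transpose)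

text \<open>The form at \<open>x + t *\<^sub>R y\<close> is a nonnegative quadratic in
  \<open>t\<close>, so its discriminant is nonpositive. If \<open>C\<close> = 0 it is affine in
  \<open>t\<close>, which forces \<open>B\<close> = 0.\<close>

lemma psd_cauchy_schwarz:
  fixes S :: "real ^ 'n ^ 'n"
  assumes S: "transpose S = S" and pos: "\<And>x. 0 \<le> x \<bullet> (S *v x)"
  shows "(x \<bullet> (S *v y))\<^sup>2 \<le> (x \<bullet> (S *v x)) * (y \<bullet> (S *v y))"
proof -
  define A B C where "A = x \<bullet> (S *v x)" and "B = x \<bullet> (S *v y)" and "C = y \<bullet> (S *v y)"
  have B': "y \<bullet> (S *v x) = B"
    unfolding B_def by (metis inner_commute inner_symmetric_matrix[OF S])
  have expand: "0 \<le> A + 2 * t * B + t\<^sup>2 * C" for t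
    using pos[of "x + t *\<^sub>R y"] B' unfolding A_def B_def C_def
    by (simp add: matrix_vector_right_distrib matrix_vector_mult_scaleR inner_add_left
        inner_add_right power2_eq_square algebra_simps)
  have AC: "A \<ge> 0" "C \<ge> 0" using pos unfolding A_def C_def by auto
  show ?thesis
  proof (cases "C = 0")
    case True
    have "B = 0"
    proof (rule ccontr)
      assume "B \<noteq> 0"
      then show False using expand[of "- (A + 1) / (2 * B)"] True AC by (simp add: field_simps)
    qed
    then show ?thesis using True by (simp add: B_def C_def flip: A_def)
  next
    case False
    have "0 \<le> A + 2 * (- B / C) * B + (- B / C)\<^sup>2 * C" by (rule expand)
    also have "\<dots> = A - B\<^sup>2 / C" using False by (simp add: field_simps power2_eq_square)
    finally show ?thesis using AC False
      by (simp add: field_simps flip: A_def B_def C_def)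
  qed
qed

lemma matrix_eq_bilinear:
  fixes A B :: "real ^ 'm ^ 'n"
  assumes "\<And>v z. v \<bullet> (A *v z) = v \<bullet> (B *v z)"
  shows "A = B"
  using assms by (metis matrix_eq vector_eq_ldot)

text \<open>Column j of \<open>R\<close> is a preimage under \<open>W\<close> of column j of
  \<open>A\<close>. With \<open>A\<close> the projector onto the range of \<open>W\<close>,
  \<open>R\<close> inverts \<open>W\<close> on that range.\<close>

lemma right_factor_exists:
  fixes W :: "real ^ 'k ^ 'n" and A :: "real ^ 'm ^ 'n"
  assumes "range ((*v) A) \<subseteq> range ((*v) W)"
  obtains R where "W ** R = A"
proof -
  have "\<forall>j. \<exists>y. A *v axis j 1 = W *v y" using assms by blast
  then obtain g where g: "\<And>j. A *v axis j 1 = W *v g j" by metis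
  define R :: "real ^ 'm ^ 'k" where "R = (\<chi> r j. g j $ r)"
  have "(W ** R) $ i $ j = A $ i $ j" for i j
  proof -
    have "(W ** R) $ i $ j = (W *v g j) $ i"
      by (simp add: R_def matrix_matrix_mult_def matrix_vector_mult_def)
    also have "\<dots> = A $ i $ j" by (simp flip: g add: matrix_vector_mult_basis column_def)
    finally show ?thesis .
  qed
  then have "W ** R = A" by (simp add: vec_eq_iff)
  then show ?thesis by (rule that)
qed

lemma gram_eq_sum_outer: "gram D = (\<Sum>j\<in>UNIV. outer (column j D))"
  by (simp add: gram_def matrix_matrix_mult_def transpose_def outer_def column_def vec_eq_iff)

lemma frob_gram: "frob (gram D) S = (\<Sum>j\<in>UNIV. column j D \<bullet> (S *v column j D))"
  by (simp add: frob_eq_inner gram_eq_sum_outer inner_commute[of _ S] inner_sum_right inner_outer)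

section \<open>Orthonormal families and semidefinite forms\<close>

lemma bessel_finite:
  fixes B :: "'a :: real_inner set"
  assumes "finite B" "pairwise orthogonal B" "\<And>x. x \<in> B \<Longrightarrow> norm x = 1"
  shows "(\<Sum>x\<in>B. (v \<bullet> x)\<^sup>2) \<le> (norm v)\<^sup>2"
proof -
  define y where "y = (\<Sum>x\<in>B. (v \<bullet> x) *\<^sub>R x)"
  have yx: "y \<bullet> x = v \<bullet> x" if x: "x \<in> B" for x
  proof -
    have "y \<bullet> x = (\<Sum>z\<in>B. if z = x then v \<bullet> x else 0)"
      unfolding y_def inner_sum_left using assms x
      by (intro sum.cong) (auto simp: pairwise_def orthogonal_def norm_eq_1)
    then show ?thesis using assms(1) x by simp
  qed
  have "y \<bullet> y = (\<Sum>x\<in>B. (v \<bullet> x) * (y \<bullet> x))"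
    by (subst (2) y_def) (simp add: inner_sum_right)
  then have yy: "y \<bullet> y = (\<Sum>x\<in>B. (v \<bullet> x)\<^sup>2)" by (simp add: yx power2_eq_square)
  have vy: "v \<bullet> y = (\<Sum>x\<in>B. (v \<bullet> x)\<^sup>2)"
    by (simp add: y_def inner_sum_right power2_eq_square)
  have "0 \<le> (v - y) \<bullet> (v - y)" by simp
  then show ?thesis
    using yy vy by (simp add: inner_diff_left inner_diff_right inner_commute[of y v] power2_norm_eq_inner)
qed

text \<open>Gram-Schmidt for the possibly degenerate form x^T S y: normalise a vector of positive
  value, pass to its S-orthogonal complement in \<open>T\<close>, and induct on the dimension. Null
  vectors of the form contribute nothing, so \<open>F\<close> need not span
  \<open>T\<close>.\<close>

lemma psd_orthonormal_family:
  fixes S :: "real ^ 'n ^ 'n"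
  assumes S: "transpose S = S" and pos: "\<And>x. 0 \<le> x \<bullet> (S *v x)" and T: "subspace T"
  shows "\<exists>F. finite F \<and> F \<subseteq> T \<and> card F \<le> dim T \<and> (\<forall>f\<in>F. f \<bullet> (S *v f) = 1) \<and>
    (\<forall>w\<in>T. w \<bullet> (S *v w) = (\<Sum>f\<in>F. (f \<bullet> (S *v w))\<^sup>2))"
  using T
proof (induction "dim T" arbitrary: T rule: less_induct)
  case less
  show ?case
  proof (cases "\<forall>w\<in>T. w \<bullet> (S *v w) = 0")
    case True
    then show ?thesis by (intro exI[of _ "{}"]) simp
  next
    case False
    then obtain g where g: "g \<in> T" "g \<bullet> (S *v g) > 0" using pos by (metis less_le)
    define f where "f = g /\<^sub>R sqrt (g \<bullet> (S *v g))"
    have fT: "f \<in> T" using g less.prems by (simp add: f_def subspace_scale)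
    have ff: "f \<bullet> (S *v f) = 1"
      using g by (simp add: f_def matrix_vector_mult_scaleR field_simps)
    define T' where "T' = {w \<in> T. f \<bullet> (S *v w) = 0}"
    have sub': "subspace T'"
      using less.prems unfolding T'_def subspace_def
      by (auto simp: matrix_vector_right_distrib matrix_vector_mult_scaleR inner_add_right)
    have "f \<notin> T'" using ff by (simp add: T'_def)
    then have "T' \<subset> T" using fT by (auto simp: T'_def)
    then have dim': "dim T' < dim T"
      using sub' less.prems by (metis dim_psubset span_eq_iff)
    obtain F where F: "finite F" "F \<subseteq> T'" "card F \<le> dim T'" "\<forall>h\<in>F. h \<bullet> (S *v h) = 1"
      "\<forall>w\<in>T'. w \<bullet> (S *v w) = (\<Sum>h\<in>F. (h \<bullet> (S *v w))\<^sup>2)"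
      using less.hyps[OF dim' sub'] by blast
    have notin: "f \<notin> F" using F(2) ff by (auto simp: T'_def)
    have orth: "h \<bullet> (S *v f) = 0" if "h \<in> F" for h
      using that F(2) inner_symmetric_matrix[OF S, of h f] by (auto simp: T'_def inner_commute)
    have "w \<bullet> (S *v w) = (\<Sum>h\<in>insert f F. (h \<bullet> (S *v w))\<^sup>2)" if w: "w \<in> T" for w
    proof -
      define \<alpha> where "\<alpha> = f \<bullet> (S *v w)"
      define w' where "w' = w - \<alpha> *\<^sub>R f"
      have w'T: "w' \<in> T'"
        using w fT less.prems ff
        by (simp add: T'_def w'_def subspace_diff subspace_scale matrix_vector_mult_diff_distrib
            matrix_vector_mult_scaleR inner_diff_right \<alpha>_def)
      have "w \<bullet> (S *v f) = \<alpha>"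
        using inner_symmetric_matrix[OF S, of w f] by (simp add: \<alpha>_def inner_commute)
      then have "w \<bullet> (S *v w) = \<alpha>\<^sup>2 + w' \<bullet> (S *v w')"
        using ff by (simp add: w'_def matrix_vector_mult_diff_distrib matrix_vector_mult_scaleR
            inner_diff_left inner_diff_right power2_eq_square flip: \<alpha>_def)
      also have "w' \<bullet> (S *v w') = (\<Sum>h\<in>F. (h \<bullet> (S *v w'))\<^sup>2)" using F(5) w'T by blast
      also have "\<dots> = (\<Sum>h\<in>F. (h \<bullet> (S *v w))\<^sup>2)"
        by (intro sum.cong refl)
          (simp add: w'_def matrix_vector_mult_diff_distrib matrix_vector_mult_scaleR
            inner_diff_right orth)
      finally show ?thesis using F(1) notin by (simp add: \<alpha>_def)
    qed
    moreover have "card (insert f F) \<le> dim T" using F(1,3) notin dim' by simp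
    ultimately show ?thesis
      using F fT ff by (intro exI[of _ "insert f F"]) (auto simp: T'_def)
  qed
qed

text \<open>The range of a symmetric matrix is the orthogonal complement of its kernel: the part
  \<open>d\<close> of \<open>u\<close> orthogonal to the range lies in the kernel, hence is
  orthogonal to \<open>u\<close> and so to itself.\<close>

lemma symmetric_range_if_orthogonal_kernel:
  fixes S :: "real ^ 'n ^ 'n"
  assumes S: "transpose S = S" and u: "\<And>v. S *v v = 0 \<Longrightarrow> u \<bullet> v = 0"
  obtains w where "u = S *v w"
proof -
  define R where "R = orth_proj (range ((*v) S))"
  have sub: "subspace (range ((*v) S))" by (simp add: linear_subspace_image)
  note R = orth_proj[OF sub, folded R_def]
  define d where "d = u - R *v u"
  have "S *v d = 0"
  proof -
    have "(S *v d) \<bullet> y = 0" for y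
    proof -
      obtain z where z: "S *v y = R *v z" using R(3) by (metis rangeE rangeI)
      have "(S *v d) \<bullet> y = d \<bullet> (R *v z)" using inner_symmetric_matrix[OF S] z by metis
      also have "\<dots> = (R *v d) \<bullet> z" using inner_symmetric_matrix[OF R(1)] .
      also have "R *v d = 0"
        by (simp add: d_def matrix_vector_mult_diff_distrib matrix_vector_mul_assoc R(2))
      finally show ?thesis by simp
    qed
    then show ?thesis by (metis inner_eq_zero_iff)
  qed
  then have "u \<bullet> d = 0" by (rule u)
  moreover have "(R *v u) \<bullet> d = 0"
    using inner_symmetric_matrix[OF R(1), of u d]
    by (simp add: d_def matrix_vector_mult_diff_distrib matrix_vector_mul_assoc R(2))
  ultimately have "d \<bullet> d = 0" by (simp add: d_def inner_diff_left)
  then have "u = R *v u" by (simp add: d_def)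
  then show ?thesis using R(3) that by (metis rangeE rangeI)
qed

text \<open>In terms of the pseudoinverse, the sum of the \<open>w j \<bullet> S (w j)\<close> is the trace of
  \<open>(\<Sum>j. u\<^sub>j u\<^sub>j\<^sup>T) S\<^sup>+\<close>: it is bounded once by the number of vectors and once by the rank of \<open>S\<close>.\<close>

lemma dominated_family_preimages:
  fixes S Q :: "real ^ 'n ^ 'n" and u :: "'l :: finite \<Rightarrow> real ^ 'n"
  assumes S: "transpose S = S" and T: "subspace T"
    and Q: "\<And>w. Q *v w \<in> T" "\<And>w. S *v (Q *v w) = S *v w"
    and dom: "\<And>v. (\<Sum>j\<in>UNIV. (u j \<bullet> v)\<^sup>2) \<le> v \<bullet> (S *v v)"
  obtains w where "\<And>j. u j = S *v w j"
    "(\<Sum>j\<in>UNIV. w j \<bullet> (S *v w j)) \<le> min (real CARD('l)) (real (dim T))"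
proof -
  have pos: "0 \<le> v \<bullet> (S *v v)" for v
    by (rule order_trans[OF _ dom[of v]]) (simp add: sum_nonneg)
  have single: "(u j \<bullet> v)\<^sup>2 \<le> v \<bullet> (S *v v)" for j v
    by (rule order_trans[OF _ dom[of v]]) (intro member_le_sum; simp)
  have "\<exists>w. u j = S *v w" for j
  proof (rule symmetric_range_if_orthogonal_kernel[OF S])
    show "u j \<bullet> v = 0" if "S *v v = 0" for v using single[of j v] that by simp
  qed blast
  then obtain w0 where w0: "\<And>j. u j = S *v w0 j" by metis
  define w where "w j = Q *v w0 j" for j
  have w: "u j = S *v w j" and wT: "w j \<in> T" for j by (simp_all add: w_def w0 Q)
  \<comment> \<open>The value t = w_j^T S w_j is also \<open>u j \<bullet> w j\<close>, so
    domination at \<open>w j\<close> reads t^2 <= t.\<close>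
  have "w j \<bullet> (S *v w j) \<le> 1" for j
  proof -
    have "(w j \<bullet> (S *v w j))\<^sup>2 \<le> w j \<bullet> (S *v w j)"
      using single[of j "w j"] by (simp add: w inner_commute)
    then show ?thesis
      using pos[of "w j"] by (cases "w j \<bullet> (S *v w j) = 0") (auto simp: power2_eq_square)
  qed
  then have "(\<Sum>j\<in>UNIV. w j \<bullet> (S *v w j)) \<le> (\<Sum>j\<in>(UNIV :: 'l set). 1)" by (rule sum_mono)
  then have card: "(\<Sum>j\<in>UNIV. w j \<bullet> (S *v w j)) \<le> real CARD('l)" by simp
  obtain F where F: "finite F" "card F \<le> dim T" "\<forall>f\<in>F. f \<bullet> (S *v f) = 1"
    "\<forall>w\<in>T. w \<bullet> (S *v w) = (\<Sum>f\<in>F. (f \<bullet> (S *v w))\<^sup>2)"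
    using psd_orthonormal_family[OF S pos T] by blast
  \<comment> \<open>The second bound comes from expanding in \<open>F\<close>:
    \<open>f \<bullet> (S *v w j)\<close> is \<open>u j \<bullet> f\<close>, and domination limits
    the contribution of each \<open>f\<close> to f^T S f = 1.\<close>
  have "(\<Sum>j\<in>UNIV. w j \<bullet> (S *v w j)) = (\<Sum>j\<in>UNIV. \<Sum>f\<in>F. (u j \<bullet> f)\<^sup>2)"
    by (intro sum.cong refl) (simp add: F(4) wT w inner_commute)
  also have "\<dots> = (\<Sum>f\<in>F. \<Sum>j\<in>UNIV. (u j \<bullet> f)\<^sup>2)" by (rule sum.swap)
  also have "\<dots> \<le> (\<Sum>f\<in>F. f \<bullet> (S *v f))" by (intro sum_mono dom)
  also have "\<dots> = real (card F)" using F(3) by simp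
  also have "\<dots> \<le> real (dim T)" using F(2) by simp
  finally show ?thesis using that[OF w] card by simp
qed

section \<open>Frames and the operator \<open>\<Gamma>\<close>\<close>

lemma frame_sum_norm_le:
  fixes X :: "real ^ 'n ^ 'm"
  assumes frame: "\<And>w. (\<Sum>i\<in>I. (c i \<bullet> w)\<^sup>2) \<le> (norm w)\<^sup>2"
  shows "(\<Sum>i\<in>I. (norm (X *v c i))\<^sup>2) \<le> (norm X)\<^sup>2"
proof -
  have "(norm (X *v v))\<^sup>2 = (\<Sum>r\<in>UNIV. (v \<bullet> X $ r)\<^sup>2)" for v
    unfolding power2_norm_eq_inner inner_vec_def[of "X *v v"]
    by (simp add: matrix_vector_mul_component inner_commute power2_eq_square)
  then have "(\<Sum>i\<in>I. (norm (X *v c i))\<^sup>2) = (\<Sum>i\<in>I. \<Sum>r\<in>UNIV. (c i \<bullet> X $ r)\<^sup>2)" by simp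
  also have "\<dots> = (\<Sum>r\<in>UNIV. \<Sum>i\<in>I. (c i \<bullet> X $ r)\<^sup>2)" by (rule sum.swap)
  also have "\<dots> \<le> (\<Sum>r\<in>UNIV. (norm (X $ r))\<^sup>2)" by (intro sum_mono frame)
  also have "\<dots> = (norm X)\<^sup>2"
    by (simp add: power2_norm_eq_inner inner_vec_def[of X])
  finally show ?thesis .
qed

text \<open>Pairing a fixed point with itself gives |X|^2 as the sum of the (c_i^T X c_i)^2, which
  Cauchy-Schwarz and the frame bound on the rows of \<open>X\<close> keep below a fraction of
  |X|^2.\<close>

lemma Gamma_op_fixpoint_zero:
  assumes frame: "\<And>w. (\<Sum>i=1..N. (c i \<bullet> w)\<^sup>2) \<le> (norm w)\<^sup>2"
    and small: "\<And>i. i \<in> {1..N} \<Longrightarrow> (norm (c i))\<^sup>2 \<le> \<kappa>" and \<kappa>: "\<kappa> < 1"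
    and X: "X = Gamma_op N c X"
  shows "X = 0"
proof (rule ccontr)
  assume "X \<noteq> 0"
  then have pos: "(norm X)\<^sup>2 > 0" by simp
  have "(norm X)\<^sup>2 = X \<bullet> Gamma_op N c X" using X by (simp add: power2_norm_eq_inner)
  also have "\<dots> = (\<Sum>i=1..N. (c i \<bullet> (X *v c i))\<^sup>2)"
    by (simp add: Gamma_op_def inner_sum_right inner_outer power2_eq_square)
  \<comment> \<open>For \<open>N\<close> = 0 nothing prevents \<open>\<kappa>\<close> from being
    negative; the maximum keeps the factor nonnegative.\<close>
  also have "\<dots> \<le> (\<Sum>i=1..N. max 0 \<kappa> * (norm (X *v c i))\<^sup>2)"
  proof (intro sum_mono)
    fix i assume i: "i \<in> {1..N}"
    have "(c i \<bullet> (X *v c i))\<^sup>2 \<le> (norm (c i))\<^sup>2 * (norm (X *v c i))\<^sup>2"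
      using Cauchy_Schwarz_ineq[of "c i" "X *v c i"] by (simp add: power2_norm_eq_inner)
    also have "\<dots> \<le> max 0 \<kappa> * (norm (X *v c i))\<^sup>2"
      using small[OF i] by (intro mult_right_mono) auto
    finally show "(c i \<bullet> (X *v c i))\<^sup>2 \<le> max 0 \<kappa> * (norm (X *v c i))\<^sup>2" .
  qed
  also have "\<dots> \<le> max 0 \<kappa> * (norm X)\<^sup>2"
    unfolding sum_distrib_left[symmetric]
    by (intro mult_left_mono frame_sum_norm_le frame) auto
  finally have "(norm X)\<^sup>2 \<le> max 0 \<kappa> * (norm X)\<^sup>2" .
  then show False using pos \<kappa> by (auto simp: max_def split: if_splits)
qed

lemma linear_Gamma_op: "linear (Gamma_op N c)"
  unfolding Gamma_op_def
  by (rule linearI)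
    (simp_all add: matrix_vector_mult_add_rdistrib inner_add_right scaleR_add_left sum.distrib
      scaleR_matrix_vector_assoc[symmetric] scaleR_sum_right)

text \<open>The system is lifted to the matrix equation X - Gamma X = sum of t_i c_i c_i^T. Its left
  side is injective in \<open>X\<close>, hence surjective, and the coefficients of the solution
  along the c_i c_i^T are the required \<open>\<tau> i\<close>.\<close>

lemma frame_system_solvable:
  fixes c :: "nat \<Rightarrow> real ^ 'n" and t :: "nat \<Rightarrow> real"
  assumes frame: "\<And>w. (\<Sum>i=1..N. (c i \<bullet> w)\<^sup>2) \<le> (norm w)\<^sup>2"
    and small: "\<And>i. i \<in> {1..N} \<Longrightarrow> (norm (c i))\<^sup>2 \<le> \<kappa>" and \<kappa>: "\<kappa> < 1"
  obtains \<tau> where "\<And>i. i \<in> {1..N} \<Longrightarrow> \<tau> i = t i + (\<Sum>j=1..N. (c i \<bullet> c j)\<^sup>2 * \<tau> j)"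
proof -
  define F where "F = (\<lambda>X. X - Gamma_op N c X)"
  have lin: "linear F" unfolding F_def by (intro linear_compose_sub linear_Gamma_op linear_ident)
  have "inj F"
    unfolding linear_injective_0[OF lin]
    using Gamma_op_fixpoint_zero[OF frame small \<kappa>] by (auto simp: F_def)
  then have "surj F" using linear_injective_imp_surjective[OF lin] by simp
  then obtain X where X: "F X = (\<Sum>i=1..N. t i *\<^sub>R outer (c i))" by (metis surjD)
  define \<tau> where "\<tau> i = t i + c i \<bullet> (X *v c i)" for i
  have "X = (\<Sum>i=1..N. \<tau> i *\<^sub>R outer (c i))"
    using X by (simp add: F_def Gamma_op_def \<tau>_def scaleR_add_left sum.distrib algebra_simps)
  then have "c i \<bullet> (X *v c i) = (\<Sum>j=1..N. (c i \<bullet> c j)\<^sup>2 * \<tau> j)" for i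
    by (simp add: quad_sum_outer power2_eq_square inner_commute mult_ac)
  then show ?thesis using that \<tau>_def by metis
qed

text \<open>Let m be the minimum of the form on the unit sphere, attained at w. If m < 0, each c_i^T
  S c_i is at least \<open>\<kappa>\<close> m, so the hypothesis at w and the frame bound give m >=
  \<open>\<kappa>\<close> m, contradicting \<open>\<kappa>\<close> < 1.\<close>

lemma quad_nonneg_of_frame_ineq:
  fixes S :: "real ^ 'n ^ 'n"
  assumes frame: "\<And>w. (\<Sum>i\<in>I. (c i \<bullet> w)\<^sup>2) \<le> (norm w)\<^sup>2"
    and small: "\<And>i. i \<in> I \<Longrightarrow> (norm (c i))\<^sup>2 \<le> \<kappa>" and \<kappa>: "0 \<le> \<kappa>" "\<kappa> < 1"
    and S: "\<And>w. (\<Sum>i\<in>I. (c i \<bullet> (S *v c i)) * (c i \<bullet> w)\<^sup>2) \<le> w \<bullet> (S *v w)"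
  shows "0 \<le> x \<bullet> (S *v x)"
proof -
  define f where "f w = w \<bullet> (S *v w)" for w
  have cont: "continuous_on (sphere 0 1) f"
    unfolding f_def by (intro continuous_intros matrix_vector_mult_linear_continuous_on)
  have "sphere (0 :: real ^ 'n) 1 \<noteq> {}"
    by (metis mem_sphere_0 empty_iff norm_axis_1)
  then obtain w where w: "norm w = 1" and least: "\<And>v. norm v = 1 \<Longrightarrow> f w \<le> f v"
    using continuous_attains_inf[OF compact_sphere _ cont] by auto
  have bound: "f w * (norm v)\<^sup>2 \<le> f v" for v
  proof (cases "v = 0")
    case False
    have "f w \<le> f (v /\<^sub>R norm v)" using False by (intro least) simp
    also have "\<dots> = f v / (norm v)\<^sup>2"
      by (simp add: f_def matrix_vector_mult_scaleR power2_eq_square field_simps)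
    finally show ?thesis using False by (simp add: field_simps)
  qed (simp add: f_def)
  have "0 \<le> f w"
  proof (rule ccontr)
    assume "\<not> 0 \<le> f w"
    then have neg: "f w < 0" by simp
    have "f w * \<kappa> \<le> f w * \<kappa> * (\<Sum>i\<in>I. (c i \<bullet> w)\<^sup>2)"
      using mult_left_mono_neg[OF frame[of w], of "f w * \<kappa>"] w neg \<kappa>
      by (simp add: mult_nonpos_nonneg)
    also have "\<dots> = (\<Sum>i\<in>I. f w * \<kappa> * (c i \<bullet> w)\<^sup>2)" by (simp add: sum_distrib_left)
    also have "\<dots> \<le> (\<Sum>i\<in>I. (c i \<bullet> (S *v c i)) * (c i \<bullet> w)\<^sup>2)"
    proof (intro sum_mono mult_right_mono)
      fix i assume "i \<in> I"
      then have "f w * \<kappa> \<le> f w * (norm (c i))\<^sup>2" using small neg by simp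
      also have "\<dots> \<le> f (c i)" by (rule bound)
      finally show "f w * \<kappa> \<le> c i \<bullet> (S *v c i)" by (simp add: f_def)
    qed simp
    also have "\<dots> \<le> f w" using S by (simp add: f_def)
    finally show False using neg \<kappa> by simp
  qed
  then show ?thesis using bound[of x] by (smt (verit) f_def mult_nonneg_nonneg zero_le_power2)
qed

section \<open>Comparison of linear systems with a common nonnegative kernel\<close>

text \<open>Here \<open>s = (I - R)\<^sup>-\<^sup>1 y\<close> and \<open>\<tau> h = (I - R)\<^sup>-\<^sup>1 (\<xi> p h)\<close> with \<open>y i = \<Sum>h. (p i h)\<^sup>2\<close>. The proof
  compares the quadratic form of \<open>R\<close> with a diagonal one weighted by \<open>s\<close>; as \<open>s\<close> may vanish, it is
  first shifted by \<open>\<epsilon>\<close>, which stays a supersolution because the rows of \<open>R\<close> sum to at most 1.\<close>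

lemma minimal_solution_comparison:
  fixes R :: "'i \<Rightarrow> 'i \<Rightarrow> real" and \<tau> p :: "'i \<Rightarrow> 'j \<Rightarrow> real"
  assumes fin: "finite I" "finite J"
    and R: "\<And>i j. R i j = R j i" "\<And>i j. 0 \<le> R i j"
    and row: "\<And>i. i \<in> I \<Longrightarrow> (\<Sum>j\<in>I. R i j) \<le> 1"
    and s0: "\<And>i. i \<in> I \<Longrightarrow> 0 \<le> s i"
    and s: "\<And>i. i \<in> I \<Longrightarrow> s i = (\<Sum>h\<in>J. (p i h)\<^sup>2) + (\<Sum>j\<in>I. R i j * s j)"
    and \<tau>: "\<And>i h. i \<in> I \<Longrightarrow> h \<in> J \<Longrightarrow> \<tau> i h = \<xi> i * p i h + (\<Sum>j\<in>I. R i j * \<tau> j h)"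
  shows "(\<Sum>h\<in>J. \<Sum>i\<in>I. \<tau> i h * (\<xi> i * p i h)) \<le> (\<Sum>i\<in>I. (\<xi> i)\<^sup>2 * s i)"
proof -
  define y where "y i = (\<Sum>h\<in>J. (p i h)\<^sup>2)" for i
  have y0: "0 \<le> y i" for i unfolding y_def by (simp add: sum_nonneg)
  have step: "(\<Sum>h\<in>J. \<Sum>i\<in>I. \<tau> i h * (\<xi> i * p i h)) \<le> (\<Sum>i\<in>I. (\<xi> i)\<^sup>2 * (s i + \<epsilon>))"
    if \<epsilon>: "\<epsilon> > 0" for \<epsilon>
  proof -
    define \<sigma> where "\<sigma> i = s i + \<epsilon>" for i
    have \<sigma>0: "\<sigma> i > 0" if "i \<in> I" for i using s0[OF that] \<epsilon> by (simp add: \<sigma>_def)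
    have super: "(\<Sum>j\<in>I. R i j * \<sigma> j) \<le> \<sigma> i - y i" if "i \<in> I" for i
    proof -
      have "(\<Sum>j\<in>I. R i j * \<sigma> j) = (\<Sum>j\<in>I. R i j * s j) + \<epsilon> * (\<Sum>j\<in>I. R i j)"
        by (simp add: \<sigma>_def algebra_simps sum.distrib sum_distrib_left)
      also have "\<dots> \<le> (\<Sum>j\<in>I. R i j * s j) + \<epsilon> * 1"
        using row[OF that] \<epsilon> by (intro add_left_mono mult_left_mono) auto
      finally show ?thesis using s[OF that] by (simp add: \<sigma>_def y_def)
    qed
    \<comment> \<open>Schur's test with the positive weight \<open>\<sigma>\<close>: each product
      \<open>v i * v j\<close> is split by the weighted mean inequality, symmetry of
      \<open>R\<close> merges the two halves, and \<open>super\<close> bounds the weighted row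
      sums.\<close>
    have quad: "(\<Sum>i\<in>I. \<Sum>j\<in>I. R i j * v i * v j) \<le> (\<Sum>i\<in>I. (v i)\<^sup>2 - (v i)\<^sup>2 * y i / \<sigma> i)"
      for v :: "'i \<Rightarrow> real"
    proof -
      have amgm: "R i j * v i * v j \<le>
          (R i j * ((v i)\<^sup>2 / \<sigma> i * \<sigma> j)) / 2 + (R j i * ((v j)\<^sup>2 / \<sigma> j * \<sigma> i)) / 2"
        if ij: "i \<in> I" "j \<in> I" for i j
      proof -
        have "0 \<le> (v i * \<sigma> j - v j * \<sigma> i)\<^sup>2 / (\<sigma> i * \<sigma> j)"
          using \<sigma>0 ij by (simp add: less_imp_le)
        also have "\<dots> = (v i)\<^sup>2 / \<sigma> i * \<sigma> j + (v j)\<^sup>2 / \<sigma> j * \<sigma> i - 2 * (v i * v j)"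
          using \<sigma>0[OF ij(1)] \<sigma>0[OF ij(2)] by (simp add: field_simps power2_eq_square)
        finally have "2 * (v i * v j) \<le> (v i)\<^sup>2 / \<sigma> i * \<sigma> j + (v j)\<^sup>2 / \<sigma> j * \<sigma> i" by simp
        from mult_left_mono[OF this R(2)[of i j]]
        have "R i j * (2 * (v i * v j)) \<le>
            R i j * ((v i)\<^sup>2 / \<sigma> i * \<sigma> j) + R j i * ((v j)\<^sup>2 / \<sigma> j * \<sigma> i)"
          unfolding distrib_left R(1)[of j i] .
        moreover have "R i j * v i * v j = R i j * (2 * (v i * v j)) / 2" by simp
        moreover have "e \<le> b / 2 + d / 2" if "a \<le> b + d" "e = a / 2" for a b d e :: real
          using that by simp
        ultimately show ?thesis by blast
      qed
      have "(\<Sum>i\<in>I. \<Sum>j\<in>I. R i j * v i * v j) \<le>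
          (\<Sum>i\<in>I. \<Sum>j\<in>I. (R i j * ((v i)\<^sup>2 / \<sigma> i * \<sigma> j)) / 2 + (R j i * ((v j)\<^sup>2 / \<sigma> j * \<sigma> i)) / 2)"
        by (intro sum_mono amgm)
      also have "\<dots> = (\<Sum>i\<in>I. \<Sum>j\<in>I. (R i j * ((v i)\<^sup>2 / \<sigma> i * \<sigma> j)) / 2)
          + (\<Sum>i\<in>I. \<Sum>j\<in>I. (R j i * ((v j)\<^sup>2 / \<sigma> j * \<sigma> i)) / 2)"
        by (simp add: sum.distrib)
      also have "(\<Sum>i\<in>I. \<Sum>j\<in>I. (R j i * ((v j)\<^sup>2 / \<sigma> j * \<sigma> i)) / 2)
          = (\<Sum>i\<in>I. \<Sum>j\<in>I. (R i j * ((v i)\<^sup>2 / \<sigma> i * \<sigma> j)) / 2)"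
        by (rule sum.swap)
      also have "(\<Sum>i\<in>I. \<Sum>j\<in>I. (R i j * ((v i)\<^sup>2 / \<sigma> i * \<sigma> j)) / 2)
          + (\<Sum>i\<in>I. \<Sum>j\<in>I. (R i j * ((v i)\<^sup>2 / \<sigma> i * \<sigma> j)) / 2)
          = (\<Sum>i\<in>I. (v i)\<^sup>2 / \<sigma> i * (\<Sum>j\<in>I. R i j * \<sigma> j))"
        by (simp add: sum.distrib[symmetric] sum_distrib_left sum_divide_distrib mult_ac)
      also have "\<dots> \<le> (\<Sum>i\<in>I. (v i)\<^sup>2 / \<sigma> i * (\<sigma> i - y i))"
        using \<sigma>0 by (intro sum_mono mult_left_mono super) (auto simp: less_imp_le)
      also have "\<dots> = (\<Sum>i\<in>I. (v i)\<^sup>2 - (v i)\<^sup>2 * y i / \<sigma> i)"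
        using \<sigma>0 by (intro sum.cong) (force simp: field_simps)+
      finally show ?thesis .
    qed
    have "(\<Sum>i\<in>I. \<tau> i h * (\<xi> i * p i h))
        \<le> (\<Sum>i\<in>I. 2 * (\<xi> i * p i h * \<tau> i h) - (\<tau> i h)\<^sup>2 * y i / \<sigma> i)" if h: "h \<in> J" for h
    proof -
      \<comment> \<open>Since \<open>\<tau>\<close> solves its system, its pairing with the data b
        equals 2<b,tau> - <tau,tau> + <tau,R tau>. In this form \<open>quad\<close> leaves only
        diagonal terms.\<close>
      have "(\<Sum>i\<in>I. \<tau> i h * (\<xi> i * p i h))
          = (\<Sum>i\<in>I. 2 * (\<xi> i * p i h * \<tau> i h) - (\<tau> i h)\<^sup>2 + (\<Sum>j\<in>I. R i j * \<tau> i h * \<tau> j h))"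
      proof (intro sum.cong refl)
        fix i assume i: "i \<in> I"
        have "(\<Sum>j\<in>I. R i j * \<tau> i h * \<tau> j h) = \<tau> i h * (\<Sum>j\<in>I. R i j * \<tau> j h)"
          by (simp add: sum_distrib_left mult_ac)
        also have "\<dots> = \<tau> i h * (\<tau> i h - \<xi> i * p i h)" using \<tau>[OF i h] by simp
        finally show "\<tau> i h * (\<xi> i * p i h)
            = 2 * (\<xi> i * p i h * \<tau> i h) - (\<tau> i h)\<^sup>2 + (\<Sum>j\<in>I. R i j * \<tau> i h * \<tau> j h)"
          by (simp add: power2_eq_square algebra_simps)
      qed
      then show ?thesis
        using quad[of "\<lambda>i. \<tau> i h"] by (simp add: sum.distrib sum_subtractf)
    qed
    then have "(\<Sum>h\<in>J. \<Sum>i\<in>I. \<tau> i h * (\<xi> i * p i h))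
        \<le> (\<Sum>h\<in>J. \<Sum>i\<in>I. 2 * (\<xi> i * p i h * \<tau> i h) - (\<tau> i h)\<^sup>2 * y i / \<sigma> i)"
      by (rule sum_mono)
    also have "\<dots> = (\<Sum>i\<in>I. \<Sum>h\<in>J. 2 * (\<xi> i * p i h * \<tau> i h) - (\<tau> i h)\<^sup>2 * y i / \<sigma> i)"
      by (rule sum.swap)
    also have "\<dots> \<le> (\<Sum>i\<in>I. (\<xi> i)\<^sup>2 * \<sigma> i)"
    proof (intro sum_mono)
      fix i assume i: "i \<in> I"
      show "(\<Sum>h\<in>J. 2 * (\<xi> i * p i h * \<tau> i h) - (\<tau> i h)\<^sup>2 * y i / \<sigma> i) \<le> (\<xi> i)\<^sup>2 * \<sigma> i"
      proof (cases "y i = 0")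
        case True
        then have "p i h = 0" if "h \<in> J" for h
          using that fin by (simp add: y_def sum_nonneg_eq_0_iff)
        then show ?thesis using True \<sigma>0[OF i] by simp
      next
        case False
        then have yi: "y i > 0" using y0[of i] by simp
        \<comment> \<open>Completing the square eliminates \<open>\<tau> i h\<close>; summing over
          \<open>h\<close> then turns the squares of \<open>p i h\<close> into \<open>y i\<close>,
          which cancels the denominator.\<close>
        have "2 * (\<xi> i * p i h * \<tau> i h) - (\<tau> i h)\<^sup>2 * y i / \<sigma> i
            \<le> (\<xi> i)\<^sup>2 * \<sigma> i / y i * (p i h)\<^sup>2" for h
        proof -
          have "0 \<le> (\<tau> i h * y i - \<xi> i * p i h * \<sigma> i)\<^sup>2 / (y i * \<sigma> i)"
            using yi \<sigma>0[OF i] by simp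
          also have "\<dots> = (\<tau> i h)\<^sup>2 * y i / \<sigma> i + (\<xi> i)\<^sup>2 * \<sigma> i / y i * (p i h)\<^sup>2
              - 2 * (\<xi> i * p i h * \<tau> i h)"
            using yi \<sigma>0[OF i] by (simp add: field_simps power2_eq_square)
          finally show ?thesis by simp
        qed
        then have "(\<Sum>h\<in>J. 2 * (\<xi> i * p i h * \<tau> i h) - (\<tau> i h)\<^sup>2 * y i / \<sigma> i)
            \<le> (\<Sum>h\<in>J. (\<xi> i)\<^sup>2 * \<sigma> i / y i * (p i h)\<^sup>2)" by (intro sum_mono)
        also have "\<dots> = (\<xi> i)\<^sup>2 * \<sigma> i"
          unfolding sum_distrib_left[symmetric] y_def[symmetric] using yi by simp
        finally show ?thesis .
      qed
    qed
    finally show ?thesis by (simp add: \<sigma>_def)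
  qed
  define X where "X = (\<Sum>i\<in>I. (\<xi> i)\<^sup>2)"
  have X0: "X \<ge> 0" unfolding X_def by (simp add: sum_nonneg)
  show ?thesis
  proof (rule field_le_epsilon)
    fix e :: real assume e: "e > 0"
    \<comment> \<open>The shift is scaled to make the total error at most \<open>e\<close>; the
      added 1 covers \<open>X\<close> = 0.\<close>
    have "(\<Sum>h\<in>J. \<Sum>i\<in>I. \<tau> i h * (\<xi> i * p i h)) \<le> (\<Sum>i\<in>I. (\<xi> i)\<^sup>2 * (s i + e / (X + 1)))"
      using e X0 by (intro step) simp
    also have "\<dots> = (\<Sum>i\<in>I. (\<xi> i)\<^sup>2 * s i) + X * (e / (X + 1))"
      unfolding X_def distrib_left sum.distrib sum_distrib_right ..
    also have "X * (e / (X + 1)) \<le> e" using X0 e by (simp add: field_simps)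
    finally show "(\<Sum>h\<in>J. \<Sum>i\<in>I. \<tau> i h * (\<xi> i * p i h)) \<le> (\<Sum>i\<in>I. (\<xi> i)\<^sup>2 * s i) + e" by simp
  qed
qed

section \<open>Residuals of critical points\<close>

lemma gram_quad: "v \<bullet> (gram W *v z) = (transpose W *v v) \<bullet> (transpose W *v z)"
  unfolding gram_def matrix_vector_mul_assoc[symmetric]
  by (metis inner_matrix_transpose transpose_transpose)

lemma gram_quad_columns: "v \<bullet> (gram W *v z) = (\<Sum>j\<in>UNIV. (column j W \<bullet> v) * (column j W \<bullet> z))"
  using quad_sum_outer[of v "\<lambda>_. 1" "\<lambda>j. column j W" UNIV z] by (simp add: gram_eq_sum_outer)

lemma Gamma_op_quad:
  "v \<bullet> (Gamma_op N a X *v z) = (\<Sum>i=1..N. (a i \<bullet> (X *v a i)) * (a i \<bullet> v) * (a i \<bullet> z))"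
  by (simp add: Gamma_op_def quad_sum_outer)

text \<open>\<open>S\<close> is its own compression by \<open>Q\<close> and equals Y_star - Y +
  Gamma S for the Gram matrices of \<open>Ws\<close> and \<open>W\<close>. Compressing this sum
  removes Y, as Q W = 0, and projects the remaining vectors by \<open>Q\<close>.\<close>

lemma residual_decomposition:
  fixes W :: "real ^ 'k ^ 'n" and Ws :: "real ^ 'l ^ 'n" and S Q :: "real ^ 'n ^ 'n"
  assumes S: "transpose S = S" "S ** Q = S" and Q: "transpose Q = Q" "Q ** W = 0"
    and res: "gram Ws - gram W = S - Gamma_op N a S"
  shows "v \<bullet> (S *v z) =
    (\<Sum>j\<in>UNIV. ((Q *v column j Ws) \<bullet> v) * ((Q *v column j Ws) \<bullet> z)) +
    (\<Sum>i=1..N. (a i \<bullet> (S *v a i)) * ((Q *v a i) \<bullet> v) * ((Q *v a i) \<bullet> z))"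
proof -
  have SQ: "S *v (Q *v y) = S *v y" for y by (simp add: matrix_vector_mul_assoc S(2))
  have S_eq: "S *v y = gram Ws *v y - gram W *v y + Gamma_op N a S *v y" for y
    using arg_cong[OF res, of "\<lambda>M. M *v y"]
    by (simp add: matrix_vector_mult_diff_rdistrib algebra_simps)
  have "v \<bullet> (S *v z) = (Q *v v) \<bullet> (S *v (Q *v z))"
    using inner_symmetric_matrix[OF S(1), of v "Q *v z"] inner_symmetric_matrix[OF S(1), of "Q *v v" "Q *v z"]
    by (simp add: SQ)
  also have "\<dots> = (Q *v v) \<bullet> (gram Ws *v (Q *v z)) - (Q *v v) \<bullet> (gram W *v (Q *v z))
      + (Q *v v) \<bullet> (Gamma_op N a S *v (Q *v z))"
    by (simp only: S_eq inner_add_right inner_diff_right)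
  also have "(Q *v v) \<bullet> (gram W *v (Q *v z)) = 0"
  proof -
    have "transpose W ** Q = transpose (Q ** W)" by (simp only: matrix_transpose_mul Q(1))
    then have "transpose W ** Q = 0" by (simp only: Q(2) transpose_zero)
    then have "transpose W *v (Q *v z) = 0" by (simp only: matrix_vector_mul_assoc matrix_vector_mult_0)
    then show ?thesis by (simp only: gram_quad inner_zero_right)
  qed
  finally show ?thesis
    by (simp add: gram_quad_columns Gamma_op_quad inner_symmetric_matrix[OF Q(1)])
qed

lemma frame_compress:
  fixes Q :: "real ^ 'n ^ 'n"
  assumes Q: "transpose Q = Q" "Q ** Q = Q"
    and frame: "\<And>w. (\<Sum>i\<in>I. (a i \<bullet> w)\<^sup>2) \<le> (norm w)\<^sup>2"
  shows "(norm (Q *v w))\<^sup>2 \<le> (norm w)\<^sup>2"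
    and "(\<Sum>i\<in>I. ((Q *v a i) \<bullet> w)\<^sup>2) \<le> (norm w)\<^sup>2"
proof -
  have "(norm (Q *v w))\<^sup>2 = w \<bullet> (Q *v w)"
    using inner_symmetric_matrix[OF Q(1), of w "Q *v w"]
    by (simp add: power2_norm_eq_inner matrix_vector_mul_assoc Q(2))
  then have "0 \<le> (norm w)\<^sup>2 - (norm (Q *v w))\<^sup>2"
    using inner_ge_zero[of "w - Q *v w"]
    by (simp add: power2_norm_eq_inner inner_diff_left inner_diff_right inner_commute)
  then show le: "(norm (Q *v w))\<^sup>2 \<le> (norm w)\<^sup>2" by simp
  show "(\<Sum>i\<in>I. ((Q *v a i) \<bullet> w)\<^sup>2) \<le> (norm w)\<^sup>2"
    using order_trans[OF frame[of "Q *v w"] le] by (simp add: inner_symmetric_matrix[OF Q(1)])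
qed

section \<open>The second-order condition in one test direction\<close>

text \<open>The direction \<open>D\<close> used in the proof is chosen so that \<open>L\<close> is explicit on it: its velocity
  \<open>W D\<^sup>T + D W\<^sup>T\<close> equals \<open>L\<^sup>-\<^sup>1 X\<close> with \<open>X = x u\<^sup>T + u x\<^sup>T + 2 \<Sum> \<tau>\<^sub>i c\<^sub>i c\<^sub>i\<^sup>T\<close>. The linear system for \<open>\<tau>\<close>
  says exactly that the block of \<open>L\<^sup>-\<^sup>1 X\<close> orthogonal to the columns of \<open>W\<close> vanishes, i.e. that
  \<open>L\<^sup>-\<^sup>1 X\<close> is tangent.\<close>

lemma second_order_direction:
  fixes W :: "real ^ 'k ^ 'n" and P Pi Q S :: "real ^ 'n ^ 'n" and a c :: "nat \<Rightarrow> real ^ 'n"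
  assumes P: "transpose P = P" "P ** P = P"
    and Pi: "transpose Pi = Pi" "Pi ** Pi = Pi" "range ((*v) Pi) = range ((*v) W)" "P ** Pi = Pi"
    and Q: "Q = P - Pi"
    and a: "\<And>i. i \<in> {1..N} \<Longrightarrow> P *v a i = a i"
    and c: "\<And>i. c i = Q *v a i"
    and S: "transpose S = S" "\<And>v. 0 \<le> v \<bullet> (S *v v)" "S ** W = 0"
    and soc: "\<And>D X. \<lbrakk>P ** D = D; transpose X = X; P ** X ** P = X;
        W ** transpose D + D ** transpose W = X - Gamma_op N a X\<rbrakk>
        \<Longrightarrow> frob (gram D) S \<le> 1 / 2 * ((X - Gamma_op N a X) \<bullet> X)"
    and x: "Pi *v x = x" and u: "Q *v u = u" "u = S *v w"
    and \<tau>: "\<And>i. i \<in> {1..N} \<Longrightarrow> \<tau> i = (a i \<bullet> x) * (a i \<bullet> u) + (\<Sum>j=1..N. (c i \<bullet> c j)\<^sup>2 * \<tau> j)"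
  shows "(norm x)\<^sup>2 * (norm u)\<^sup>2 - 2 * (\<Sum>i=1..N. \<tau> i * ((a i \<bullet> x) * (a i \<bullet> u)))
    \<le> (norm (transpose W *v x))\<^sup>2 * (w \<bullet> (S *v w))"
proof -
  \<comment> \<open>polarized form of \<open>x u\<^sup>T + u x\<^sup>T\<close>\<close>
  define X where "X = outer (x + u) - outer x - outer u + (\<Sum>i=1..N. (2 * \<tau> i) *\<^sub>R outer (c i))"
  define Y where "Y = X - Gamma_op N a X"
  note symP = inner_symmetric_matrix[OF P(1)] and symPi = inner_symmetric_matrix[OF Pi(1)]
  have PiP: "Pi ** P = Pi"
    using Pi(1,4) P(1) by (metis matrix_transpose_mul)
  have Qt: "transpose Q = Q" by (simp add: Q transpose_minus P Pi)
  note symQ = inner_symmetric_matrix[OF Qt]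
  have Qv: "Q *v v = P *v v - Pi *v v" for v by (simp add: Q matrix_vector_mult_diff_rdistrib)
  have PPv: "P *v (P *v v) = P *v v" and PPiv: "P *v (Pi *v v) = Pi *v v"
    and PiPv: "Pi *v (P *v v) = Pi *v v" and PiPiv: "Pi *v (Pi *v v) = Pi *v v" for v
    by (simp_all add: matrix_vector_mul_assoc P Pi PiP)
  have PQv: "P *v (Q *v v) = Q *v v" and QQv: "Q *v (Q *v v) = Q *v v"
    and PiQv: "Pi *v (Q *v v) = 0" for v
    by (simp_all add: Qv matrix_vector_mult_diff_distrib PPv PPiv PiPv PiPiv)
  have Px: "P *v x = x" using PPiv[of x] x by simp
  have Pu: "P *v u = u" using PQv[of u] u by simp
  have Pc: "P *v c i = c i" for i by (simp add: c PQv)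
  have Qx: "Q *v x = 0" by (simp add: Qv Px x)
  have xu: "x \<bullet> u = 0" using symQ[of x u] Qx u(1) by simp
  have cQ: "c i \<bullet> v = a i \<bullet> (Q *v v)" for i v using symQ[of "a i" v] by (simp add: c)
  have cQ': "c i \<bullet> (Q *v v) = c i \<bullet> v" for i v by (simp add: cQ QQv)
  have cc: "c j \<bullet> a i = c j \<bullet> c i" for i j by (metis cQ' c)
  have cx: "c i \<bullet> x = 0" for i by (simp add: cQ Qx)
  have quadX: "v \<bullet> (X *v z) = (x \<bullet> v) * (u \<bullet> z) + (u \<bullet> v) * (x \<bullet> z)
      + (\<Sum>i=1..N. 2 * \<tau> i * (c i \<bullet> v) * (c i \<bullet> z))" for v z
    unfolding X_def matrix_vector_mult_add_rdistrib matrix_vector_mult_diff_rdistrib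
      inner_add_right inner_diff_right quad_sum_outer
    by (simp add: outer_mult_vec inner_add_left inner_add_right inner_commute[of v] algebra_simps)
  \<comment> \<open>The cross term of \<open>X\<close> gives the inhomogeneity of the system for
    \<open>\<tau>\<close>, and \<open>cc\<close> turns the other terms into its kernel. Thus
    \<open>Gamma_op\<close> reproduces the coefficients of \<open>X\<close>.\<close>
  have aXa: "a i \<bullet> (X *v a i) = 2 * \<tau> i" if "i \<in> {1..N}" for i
  proof -
    have "a i \<bullet> (X *v a i) = 2 * ((a i \<bullet> x) * (a i \<bullet> u)) + (\<Sum>j=1..N. 2 * ((c i \<bullet> c j)\<^sup>2 * \<tau> j))"
      unfolding quadX cc by (simp add: inner_commute power2_eq_square mult_ac)
    also have "\<dots> = 2 * \<tau> i" using \<tau>[OF that] by (simp flip: sum_distrib_left)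
    finally show ?thesis .
  qed
  have \<Gamma>X: "Gamma_op N a X = (\<Sum>i=1..N. (2 * \<tau> i) *\<^sub>R outer (a i))"
    unfolding Gamma_op_def by (intro sum.cong refl) (simp add: aXa)
  have quadY: "v \<bullet> (Y *v z) = (x \<bullet> v) * (u \<bullet> z) + (u \<bullet> v) * (x \<bullet> z)
      + (\<Sum>i=1..N. 2 * \<tau> i * (c i \<bullet> v) * (c i \<bullet> z)) - (\<Sum>i=1..N. 2 * \<tau> i * (a i \<bullet> v) * (a i \<bullet> z))"
    for v z
    unfolding Y_def \<Gamma>X by (simp add: matrix_vector_mult_diff_rdistrib inner_diff_right quadX quad_sum_outer)
  have Xt: "transpose X = X"
    unfolding X_def by (simp add: transpose_plus transpose_minus transpose_sum transpose_scalar)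
  have Yt: "transpose Y = Y"
    unfolding Y_def \<Gamma>X by (simp add: Xt transpose_minus transpose_sum transpose_scalar)
  have P_inner: "v \<bullet> (P *v z) = v \<bullet> z" if "P *v v = v" for v z using symP[of v z] that by simp
  have PXP: "P ** X ** P = X"
  proof (rule matrix_eq_bilinear)
    fix v z
    have "v \<bullet> ((P ** X ** P) *v z) = (P *v v) \<bullet> (X *v (P *v z))"
      by (simp add: symP flip: matrix_vector_mul_assoc)
    also have "\<dots> = v \<bullet> (X *v z)" by (simp add: quadX P_inner Px Pu Pc)
    finally show "v \<bullet> ((P ** X ** P) *v z) = v \<bullet> (X *v z)" .
  qed
  have YP: "(P *v v) \<bullet> (Y *v (P *v z)) = v \<bullet> (Y *v z)" for v z
  proof -
    have "(\<Sum>i=1..N. 2 * \<tau> i * (a i \<bullet> (P *v v)) * (a i \<bullet> (P *v z)))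
        = (\<Sum>i=1..N. 2 * \<tau> i * (a i \<bullet> v) * (a i \<bullet> z))"
      by (intro sum.cong refl) (simp add: P_inner a)
    then show ?thesis unfolding quadY by (simp add: P_inner Px Pu Pc)
  qed
  \<comment> \<open>Compression by \<open>Q\<close> replaces each \<open>a i\<close> by
    \<open>c i\<close>, so the two \<open>\<tau>\<close>-sums cancel; the cross term goes because Q
    x = 0.\<close>
  have QYQ: "(Q *v v) \<bullet> (Y *v (Q *v z)) = 0" for v z
  proof -
    have "x \<bullet> (Q *v v) = 0" for v using symQ[of x v] Qx by simp
    then show ?thesis by (simp add: quadY cQ' flip: cQ)
  qed
  obtain R where R: "W ** R = Pi" using right_factor_exists Pi(3) by (metis order_refl)
  \<comment> \<open>As W R = Pi, the product D W^T is (Y - Pi Y / 2) Pi. The subtracted half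
    corrects for Pi Y Pi appearing in both this matrix and its transpose.\<close>
  define D where "D = (Y - (1/2) *\<^sub>R (Pi ** Y)) ** transpose R"
  have PY: "P ** Y = Y"
  proof (rule matrix_eq_bilinear)
    fix v z
    have "v \<bullet> ((P ** Y) *v z) = (P *v v) \<bullet> (Y *v z)"
      by (simp add: symP flip: matrix_vector_mul_assoc)
    also have "\<dots> = v \<bullet> (Y *v z)" using YP[of "P *v v" z] YP[of v z] by (simp add: PPv)
    finally show "v \<bullet> ((P ** Y) *v z) = v \<bullet> (Y *v z)" .
  qed
  have PD: "P ** D = D"
  proof -
    have "P *v ((Y - (1/2) *\<^sub>R (Pi ** Y)) *v v) = (Y - (1/2) *\<^sub>R (Pi ** Y)) *v v" for v
      using PY PPiv by (simp add: matrix_vector_mult_diff_rdistrib matrix_vector_mult_diff_distrib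
          matrix_vector_mult_scaleR matrix_vector_mul_assoc matrix_mul_assoc Pi(4)
          flip: scaleR_matrix_vector_assoc)
    then show ?thesis unfolding D_def matrix_eq by (simp flip: matrix_vector_mul_assoc)
  qed
  have tangent: "W ** transpose D + D ** transpose W = Y"
  proof (rule matrix_eq_bilinear)
    fix v z
    have D': "D ** transpose W = (Y - (1/2) *\<^sub>R (Pi ** Y)) ** Pi"
      unfolding D_def by (metis R Pi(1) matrix_mul_assoc matrix_transpose_mul)
    have half: "v \<bullet> ((D ** transpose W) *v z) = v \<bullet> (Y *v (Pi *v z)) - 1/2 * ((Pi *v v) \<bullet> (Y *v (Pi *v z)))"
      for v z
      unfolding D' by (simp add: matrix_vector_mult_diff_rdistrib inner_diff_right symPi
          flip: matrix_vector_mul_assoc scaleR_matrix_vector_assoc)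
    have "W ** transpose D = transpose (D ** transpose W)" by (simp add: matrix_transpose_mul)
    then have "v \<bullet> ((W ** transpose D) *v z) = z \<bullet> ((D ** transpose W) *v v)"
      by (metis inner_matrix_transpose inner_commute)
    then have "v \<bullet> ((W ** transpose D + D ** transpose W) *v z) =
        v \<bullet> (Y *v (Pi *v z)) + z \<bullet> (Y *v (Pi *v v))
        - 1/2 * ((Pi *v v) \<bullet> (Y *v (Pi *v z))) - 1/2 * ((Pi *v z) \<bullet> (Y *v (Pi *v v)))"
      by (simp add: matrix_vector_mult_add_rdistrib inner_add_right half)
    also have "\<dots> = v \<bullet> (Y *v (Pi *v z)) + (Pi *v v) \<bullet> (Y *v z) - (Pi *v v) \<bullet> (Y *v (Pi *v z))"
      using inner_symmetric_matrix[OF Yt, of z "Pi *v v"] inner_symmetric_matrix[OF Yt, of "Pi *v z" "Pi *v v"]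
      by (simp add: inner_commute)
    also have "\<dots> = v \<bullet> (Y *v z)"
      using QYQ[of v z] YP[of v z] YP[of v "Pi *v z"] YP[of "Pi *v v" z]
      by (simp add: Qv matrix_vector_mult_diff_distrib inner_diff_left inner_diff_right PPiv)
    finally show "v \<bullet> ((W ** transpose D + D ** transpose W) *v z) = v \<bullet> (Y *v z)" .
  qed
  define q where "q = frob (gram D) S"
  define \<zeta> where "\<zeta> = x \<bullet> (Y *v u)"
  have \<zeta>: "\<zeta> = (norm x)\<^sup>2 * (norm u)\<^sup>2 - 2 * (\<Sum>i=1..N. \<tau> i * ((a i \<bullet> x) * (a i \<bullet> u)))"
    unfolding \<zeta>_def quadY
    by (simp add: cx xu inner_commute[of u x] power2_norm_eq_inner sum_distrib_left mult_ac)
  \<comment> \<open>The terms of \<open>X\<close> along the \<open>c i\<close> pair to zero by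
    \<open>QYQ\<close>, so only the cross term counts and second-order criticality becomes q <=
    \<open>\<zeta>\<close>.\<close>
  have "Y \<bullet> X = 2 * \<zeta>"
  proof -
    have "c i \<bullet> (Y *v c i) = 0" for i using QYQ by (simp add: c)
    moreover have "u \<bullet> (Y *v x) = \<zeta>"
      unfolding \<zeta>_def using inner_symmetric_matrix[OF Yt, of u x] by (simp add: inner_commute)
    ultimately show ?thesis
      by (simp add: X_def inner_add_right inner_diff_right inner_sum_right inner_outer
          matrix_vector_right_distrib inner_add_left \<zeta>_def)
  qed
  then have q: "q \<le> \<zeta>" using soc[OF PD Xt PXP] tangent by (simp add: q_def Y_def)
  have q0: "q \<ge> 0" unfolding q_def frob_gram by (intro sum_nonneg S)
  \<comment> \<open>Because u = S w, the entries of D^T u are S-products of the columns of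
    \<open>D\<close> with \<open>w\<close>; Cauchy-Schwarz for the S-form brings back
    \<open>q\<close>.\<close>
  have Dtu: "(norm (transpose D *v u))\<^sup>2 \<le> (w \<bullet> (S *v w)) * q"
  proof -
    have "(norm (transpose D *v u))\<^sup>2 = (\<Sum>j\<in>UNIV. (column j D \<bullet> (S *v w))\<^sup>2)"
      unfolding power2_norm_eq_inner inner_vec_def[of "transpose D *v u"]
      by (simp add: matrix_vector_mul_component u(2) power2_eq_square column_def transpose_def
          del: transpose_matrix_vector)
    also have "\<dots> \<le> (\<Sum>j\<in>UNIV. (column j D \<bullet> (S *v column j D)) * (w \<bullet> (S *v w)))"
      by (intro sum_mono psd_cauchy_schwarz S)
    finally show ?thesis by (simp add: q_def frob_gram sum_distrib_left mult_ac)
  qed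
  have "transpose W *v u = 0"
  proof -
    have "transpose W ** S = transpose (S ** W)" by (simp only: matrix_transpose_mul S(1))
    then have "transpose W ** S = 0" using S(3) by (simp only: transpose_zero)
    then show ?thesis unfolding u(2) matrix_vector_mul_assoc by simp
  qed
  then have "Y *v u = W *v (transpose D *v u)"
    unfolding tangent[symmetric] matrix_vector_mult_add_rdistrib
    by (simp add: matrix_vector_mul_assoc[symmetric] del: transpose_matrix_vector)
  then have "\<zeta> = (transpose W *v x) \<bullet> (transpose D *v u)"
    unfolding \<zeta>_def by (metis inner_matrix_transpose transpose_transpose)
  then have "\<zeta>\<^sup>2 \<le> (norm (transpose W *v x))\<^sup>2 * (norm (transpose D *v u))\<^sup>2"
    using Cauchy_Schwarz_ineq by (metis power2_norm_eq_inner)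
  also have "\<dots> \<le> (norm (transpose W *v x))\<^sup>2 * ((w \<bullet> (S *v w)) * q)"
    by (intro mult_left_mono Dtu) simp
  also have "\<dots> \<le> (norm (transpose W *v x))\<^sup>2 * ((w \<bullet> (S *v w)) * \<zeta>)"
    using S(2) q by (intro mult_left_mono) auto
  finally have main: "\<zeta> * \<zeta> \<le> ((norm (transpose W *v x))\<^sup>2 * (w \<bullet> (S *v w))) * \<zeta>"
    by (simp add: power2_eq_square mult_ac)
  have "\<zeta> \<le> (norm (transpose W *v x))\<^sup>2 * (w \<bullet> (S *v w))"
  proof (cases "\<zeta> = 0")
    case True
    then show ?thesis using S(2) by simp
  next
    case False
    then have "\<zeta> > 0" using q q0 by simp
    then show ?thesis using main by simp
  qed
  then show ?thesis by (simp add: \<zeta>)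
qed

text \<open>First-order criticality confines \<open>S\<close> to the complement of the range of
  \<open>W\<close>. There \<open>S\<close> is a Gram matrix plus the sum of the s_i c_i c_i^T, and
  dropping the Gram part gives the inequality required by
  \<open>quad_nonneg_of_frame_ineq\<close>.\<close>

lemma critical_residual_psd:
  fixes W :: "real ^ 'k ^ 'n" and Ws :: "real ^ 'l ^ 'n" and S :: "real ^ 'n ^ 'n"
  assumes S: "transpose S = S" "S ** W = 0"
    and res: "gram Ws - gram W = S - Gamma_op N a S"
    and frame: "\<And>w. (\<Sum>i=1..N. (a i \<bullet> w)\<^sup>2) \<le> (norm w)\<^sup>2"
    and small: "\<And>i. i \<in> {1..N} \<Longrightarrow> (norm (a i))\<^sup>2 \<le> 1 - \<eta>" and \<eta>: "0 < \<eta>" "\<eta> \<le> 1"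
  shows "0 \<le> v \<bullet> (S *v v)"
proof -
  define Pi where "Pi = orth_proj (range ((*v) W))"
  define Q where "Q = mat 1 - Pi"
  have "subspace (range ((*v) W))" by (simp add: linear_subspace_image)
  note Pi = orth_proj[OF this, folded Pi_def]
  have Qv: "Q *v y = y - Pi *v y" for y by (simp add: Q_def matrix_vector_mult_diff_rdistrib)
  have PiPi: "Pi *v (Pi *v y) = Pi *v y" for y by (simp add: matrix_vector_mul_assoc Pi)
  have Qt: "transpose Q = Q" by (simp add: Q_def transpose_minus Pi)
  have QQ: "Q ** Q = Q"
    unfolding matrix_eq
    by (simp add: Qv matrix_vector_mult_diff_distrib PiPi flip: matrix_vector_mul_assoc)
  have "Pi *v (W *v y) = W *v y" for y using PiPi Pi(3) by (metis rangeE rangeI)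
  then have QW: "Q ** W = 0" unfolding matrix_eq by (simp add: Qv flip: matrix_vector_mul_assoc)
  have "S *v (W *v y) = 0" for y by (simp add: matrix_vector_mul_assoc S(2))
  then have "S *v (Pi *v y) = 0" for y using Pi(3) by (metis rangeE rangeI)
  then have SQv: "S *v (Q *v y) = S *v y" for y by (simp add: Qv matrix_vector_mult_diff_distrib)
  then have SQ: "S ** Q = S" unfolding matrix_eq by (simp flip: matrix_vector_mul_assoc)
  have quad: "(Q *v y) \<bullet> (S *v (Q *v y)) = y \<bullet> (S *v y)" for y
    by (simp only: SQv inner_symmetric_matrix[OF S(1), of "Q *v y" y] inner_commute[of "S *v y" y])
  show ?thesis
  proof (rule quad_nonneg_of_frame_ineq)
    show "(\<Sum>i=1..N. ((Q *v a i) \<bullet> w)\<^sup>2) \<le> (norm w)\<^sup>2" for w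
      by (rule frame_compress(2)[OF Qt QQ frame])
    show "(norm (Q *v a i))\<^sup>2 \<le> 1 - \<eta>" if "i \<in> {1..N}" for i
      using frame_compress(1)[OF Qt QQ frame] small[OF that] by (rule order_trans)
    show "0 \<le> 1 - \<eta>" "1 - \<eta> < 1" using \<eta> by auto
    show "(\<Sum>i=1..N. ((Q *v a i) \<bullet> (S *v (Q *v a i))) * ((Q *v a i) \<bullet> w)\<^sup>2) \<le> w \<bullet> (S *v w)" for w
      unfolding quad residual_decomposition[OF S(1) SQ Qt QW res, of w w]
      by (simp add: power2_eq_square mult_ac sum_nonneg)
  qed
qed

section \<open>The case of an injective factor\<close>

text \<open>The condition \<open>soc\<close> is second-order criticality parametrised by X =
  L(velocity): the velocity is then X - Gamma X, so \<open>L\<close> itself need not be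
  mentioned.\<close>

lemma second_order_full_rank_residual_zero:
  fixes W :: "real ^ 'k ^ 'n" and Ws :: "real ^ 'l ^ 'n" and S :: "real ^ 'n ^ 'n"
  assumes U: "subspace U" and WU: "range ((*v) W) \<subseteq> U" and rank: "dim (range ((*v) W)) = CARD('k)"
    and a: "\<And>i. i \<in> {1..N} \<Longrightarrow> a i \<in> U"
    and frame: "\<And>w. (\<Sum>i=1..N. (a i \<bullet> w)\<^sup>2) \<le> (norm w)\<^sup>2"
    and small: "\<And>i. i \<in> {1..N} \<Longrightarrow> (norm (a i))\<^sup>2 \<le> 1 - \<eta>" and \<eta>: "0 < \<eta>" "\<eta> \<le> 1"
    and S: "S \<in> sym_mats_on U" "S ** W = 0"
    and res: "gram Ws - gram W = S - Gamma_op N a S"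
    and soc: "\<And>D X. \<lbrakk>orth_proj U ** D = D; X \<in> sym_mats_on U;
        W ** transpose D + D ** transpose W = X - Gamma_op N a X\<rbrakk>
        \<Longrightarrow> frob (gram D) S \<le> 1 / 2 * ((X - Gamma_op N a X) \<bullet> X)"
    and gap: "real CARD('k) - real CARD('l)
        > (1 - \<eta>) * (min (real CARD('l)) (real (dim U) - real CARD('k)) + 2)"
  shows "S = 0"
proof -
  define V where "V = range ((*v) W)"
  define P where "P = orth_proj U"
  define Pi where "Pi = orth_proj V"
  define Q where "Q = P - Pi"
  define c where "c i = Q *v a i" for i
  define u where "u j = Q *v column j Ws" for j
  define s where "s i = a i \<bullet> (S *v a i)" for i
  define T where "T = {y \<in> U. \<forall>x\<in>V. orthogonal x y}"
  have V: "subspace V" by (simp add: V_def linear_subspace_image)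
  note P = orth_proj[OF U, folded P_def] and Pi = orth_proj[OF V, folded Pi_def]
  have PU: "P *v v = v" if "v \<in> U" for v
    using that P(2,3) by (metis rangeE matrix_vector_mul_assoc)
  have PiV: "Pi *v v = v" if "v \<in> V" for v
    using that Pi(2,3) by (metis rangeE matrix_vector_mul_assoc)
  have PiU: "Pi *v v \<in> U" for v using Pi(3) WU by (auto simp: V_def)
  have PPi: "P ** Pi = Pi"
    unfolding matrix_eq by (simp add: PU PiU flip: matrix_vector_mul_assoc)
  have PiP: "Pi ** P = Pi" using PPi Pi(1) P(1) by (metis matrix_transpose_mul)
  have Qv: "Q *v v = P *v v - Pi *v v" for v by (simp add: Q_def matrix_vector_mult_diff_rdistrib)
  have Qt: "transpose Q = Q" by (simp add: Q_def transpose_minus P Pi)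
  note symQ = inner_symmetric_matrix[OF Qt]
  have idem: "P *v (P *v v) = P *v v" "P *v (Pi *v v) = Pi *v v"
    "Pi *v (P *v v) = Pi *v v" "Pi *v (Pi *v v) = Pi *v v" for v
    by (simp_all add: matrix_vector_mul_assoc P Pi PPi PiP)
  have QQv: "Q *v (Q *v v) = Q *v v" for v
    by (simp add: Qv matrix_vector_mult_diff_distrib idem)
  have QQ: "Q ** Q = Q"
    unfolding matrix_eq by (simp add: QQv flip: matrix_vector_mul_assoc)
  have QV: "Q *v v = 0" if "v \<in> V" for v
    using that PU WU by (auto simp: Qv PiV V_def[symmetric])
  have QW: "Q ** W = 0"
    unfolding matrix_eq using QV by (simp add: V_def flip: matrix_vector_mul_assoc)
  have St: "transpose S = S" and SP: "P ** S ** P = S"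
    using S(1) by (simp_all add: sym_mats_on_def sym_mats_def P_def)
  have SV: "S *v v = 0" if "v \<in> V" for v
    using that S(2) by (auto simp: V_def matrix_vector_mul_assoc)
  have SPi: "S *v (Pi *v v) = 0" for v using SV Pi(3) by blast
  have SPr: "S ** P = S" using SP P(2) by (metis matrix_mul_assoc)
  have SPv: "S *v (P *v v) = S *v v" for v by (simp add: matrix_vector_mul_assoc SPr)
  have SQv: "S *v (Q *v v) = S *v v" for v
    by (simp add: Qv matrix_vector_mult_diff_distrib SPi SPv)
  have SQ: "S ** Q = S"
    unfolding matrix_eq by (simp add: SQv flip: matrix_vector_mul_assoc)
  note pos = critical_residual_psd[OF St S(2) res frame small \<eta>]
  note dec = residual_decomposition[OF St SQ Qt QW res, folded c_def u_def s_def]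
  have cframe: "(\<Sum>i=1..N. (c i \<bullet> w)\<^sup>2) \<le> (norm w)\<^sup>2" for w
    unfolding c_def by (rule frame_compress(2)[OF Qt QQ frame])
  have csmall: "(norm (c i))\<^sup>2 \<le> 1 - \<eta>" if "i \<in> {1..N}" for i
    unfolding c_def using frame_compress(1)[OF Qt QQ frame] small[OF that] by (rule order_trans)
  have s0: "0 \<le> s i" for i unfolding s_def by (rule pos)
  have s_c: "c i \<bullet> (S *v c i) = s i" for i
    by (simp only: c_def s_def SQv inner_symmetric_matrix[OF St, of "Q *v a i" "a i"]
        inner_commute[of "S *v a i" "a i"])
  have au: "a i \<bullet> u j = c i \<bullet> u j" for i j
    using symQ[of "a i" "u j"] by (simp add: c_def u_def QQv)
  \<comment> \<open>The decomposition at \<open>c i\<close> shows that \<open>s\<close> solves a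
    system with the same kernel as the one for \<open>\<tau>\<close>, with sums of squares as
    data.\<close>
  have s_eq: "s i = (\<Sum>j\<in>UNIV. (a i \<bullet> u j)\<^sup>2) + (\<Sum>k=1..N. (c i \<bullet> c k)\<^sup>2 * s k)" for i
    using dec[of "c i" "c i"] by (simp add: s_c au power2_eq_square inner_commute mult_ac)
  have row: "(\<Sum>k=1..N. (c i \<bullet> c k)\<^sup>2) \<le> 1" if "i \<in> {1..N}" for i
    using cframe[of "c i"] csmall[OF that] \<eta> by (simp add: inner_commute)
  have T: "subspace T"
    unfolding T_def using U by (auto simp: subspace_def orthogonal_clauses)
  have QT: "Q *v v \<in> T" for v
  proof -
    have "x \<bullet> (Q *v v) = 0" if "x \<in> V" for x using symQ[of x v] QV[OF that] by simp
    moreover have "Q *v v \<in> U"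
      unfolding Qv using U WU P(3) Pi(3) by (metis V_def rangeI subsetD subspace_diff)
    ultimately show ?thesis by (simp add: T_def orthogonal_def)
  qed
  have dimT: "dim T + CARD('k) = dim U"
    using dim_subspace_orthogonal_to_vectors[OF V U] WU rank by (simp add: T_def V_def)
  have dom: "(\<Sum>j\<in>UNIV. (u j \<bullet> v)\<^sup>2) \<le> v \<bullet> (S *v v)" for v
    unfolding dec[of v v] using s0 by (simp add: power2_eq_square mult.assoc sum_nonneg)
  obtain w where w: "\<And>j. u j = S *v w j"
    and w_sum: "(\<Sum>j\<in>UNIV. w j \<bullet> (S *v w j)) \<le> min (real CARD('l)) (real (dim T))"
    using dominated_family_preimages[OF St T QT SQv dom] by blast
  define r where "r = min (real CARD('l)) (real (dim T))"
  define \<theta> where "\<theta> = (\<Sum>j\<in>UNIV. (norm (u j))\<^sup>2)"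
  have \<theta>0: "0 \<le> \<theta>" unfolding \<theta>_def by (simp add: sum_nonneg)
  \<comment> \<open>Within \<open>V\<close>, orthogonality to the projected columns of
    \<open>Ws\<close> is orthogonality to the columns themselves. These are at most l conditions, so
    \<open>K\<close> has dimension at least k - l.\<close>
  define A where "A = span (range (\<lambda>j. Pi *v column j Ws))"
  define K where "K = {y \<in> V. \<forall>x\<in>A. orthogonal x y}"
  have "A \<subseteq> V" unfolding A_def using V Pi(3) by (intro span_minimal) auto
  then have dimK: "dim K + dim A = CARD('k)"
    using dim_subspace_orthogonal_to_vectors[of A V] V rank by (simp add: K_def V_def A_def)
  have "dim A \<le> card (range (\<lambda>j. Pi *v column j Ws))"
    unfolding A_def dim_span by (intro dim_le_card') simp
  also have "\<dots> \<le> CARD('l)" by (rule card_image_le) simp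
  finally have dimA: "dim A \<le> CARD('l)" .
  have K: "subspace K"
    unfolding K_def using V by (auto simp: subspace_def orthogonal_clauses)
  have Kcol: "column j Ws \<bullet> x = 0" if x: "x \<in> K" for j x
  proof -
    have "(Pi *v column j Ws) \<bullet> x = 0"
      using x by (auto simp: K_def A_def orthogonal_def span_base)
    then show ?thesis using inner_symmetric_matrix[OF Pi(1), of "column j Ws" x] x PiV[of x] by (simp add: K_def)
  qed
  define \<rho> where "\<rho> x = (\<Sum>i=1..N. (a i \<bullet> x)\<^sup>2 * s i)" for x
  have \<rho>: "(norm (transpose W *v x))\<^sup>2 = \<rho> x" if x: "x \<in> K" for x
  proof -
    have "S *v x = 0" using x SV by (simp add: K_def)
    then have "x \<bullet> (gram W *v x) = x \<bullet> (gram Ws *v x) + x \<bullet> (Gamma_op N a S *v x)"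
      using arg_cong[OF res, of "\<lambda>M. x \<bullet> (M *v x)"]
      by (simp add: matrix_vector_mult_diff_rdistrib inner_diff_right)
    also have "\<dots> = \<rho> x"
      by (simp add: gram_quad_columns Gamma_op_quad Kcol[OF x] \<rho>_def s_def power2_eq_square mult_ac)
    finally show ?thesis by (simp only: gram_quad power2_norm_eq_inner)
  qed
  have key: "\<theta> \<le> (r + 2) * \<rho> x" if x: "x \<in> K" "norm x = 1" for x
  proof -
    have xV: "Pi *v x = x" using x PiV by (simp add: K_def)
    have "\<exists>\<tau>. \<forall>i\<in>{1..N}. \<tau> i = (a i \<bullet> x) * (a i \<bullet> u j) + (\<Sum>k=1..N. (c i \<bullet> c k)\<^sup>2 * \<tau> k)" for j
    proof (rule frame_system_solvable[OF cframe csmall, of "\<lambda>i. (a i \<bullet> x) * (a i \<bullet> u j)"])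
      show "1 - \<eta> < 1" using \<eta> by simp
    qed blast+
    then obtain \<tau> where \<tau>: "\<And>i j. i \<in> {1..N} \<Longrightarrow>
        \<tau> j i = (a i \<bullet> x) * (a i \<bullet> u j) + (\<Sum>k=1..N. (c i \<bullet> c k)\<^sup>2 * \<tau> j k)"
      by metis
    have dir: "(norm (u j))\<^sup>2 - 2 * (\<Sum>i=1..N. \<tau> j i * ((a i \<bullet> x) * (a i \<bullet> u j)))
        \<le> \<rho> x * (w j \<bullet> (S *v w j))" for j
    proof -
      have "(norm x)\<^sup>2 * (norm (u j))\<^sup>2 - 2 * (\<Sum>i=1..N. \<tau> j i * ((a i \<bullet> x) * (a i \<bullet> u j)))
        \<le> (norm (transpose W *v x))\<^sup>2 * (w j \<bullet> (S *v w j))"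
      proof (rule second_order_direction[OF P(1,2) Pi(1,2) _ PPi Q_def _ c_def St pos S(2) _ xV _ w \<tau>])
        show "range ((*v) Pi) = range ((*v) W)" using Pi(3) by (simp add: V_def)
        show "P *v a i = a i" if "i \<in> {1..N}" for i using PU a that by blast
        show "Q *v u j = u j" by (simp add: u_def QQv)
        show "frob (gram D) S \<le> 1 / 2 * ((X - Gamma_op N a X) \<bullet> X)"
          if "P ** D = D" "transpose X = X" "P ** X ** P = X"
            "W ** transpose D + D ** transpose W = X - Gamma_op N a X" for D X
          using that by (intro soc) (simp_all add: sym_mats_on_def sym_mats_def P_def)
      qed
      then show ?thesis by (simp add: x(2) \<rho>[OF x(1)] del: transpose_matrix_vector)
    qed
    \<comment> \<open>The systems for \<open>s\<close> and \<open>\<tau> j\<close> share a kernel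
      whose rows sum to at most 1, so the correction terms cost at most 2 \<open>\<rho> x\<close>:
      this is the 2 in \<open>r + 2\<close>.\<close>
    have comp: "(\<Sum>j\<in>UNIV. \<Sum>i=1..N. \<tau> j i * ((a i \<bullet> x) * (a i \<bullet> u j))) \<le> \<rho> x"
      unfolding \<rho>_def
    proof (rule minimal_solution_comparison[where R = "\<lambda>i k. (c i \<bullet> c k)\<^sup>2" and \<tau> = "\<lambda>i j. \<tau> j i"
          and \<xi> = "\<lambda>i. a i \<bullet> x" and p = "\<lambda>i j. a i \<bullet> u j"])
      show "(c i \<bullet> c k)\<^sup>2 = (c k \<bullet> c i)\<^sup>2" for i k by (simp add: inner_commute)
    qed (rule s_eq | erule \<tau> | erule row | rule s0 | simp)+
    have "\<theta> - 2 * (\<Sum>j\<in>UNIV. \<Sum>i=1..N. \<tau> j i * ((a i \<bullet> x) * (a i \<bullet> u j)))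
        = (\<Sum>j\<in>UNIV. (norm (u j))\<^sup>2 - 2 * (\<Sum>i=1..N. \<tau> j i * ((a i \<bullet> x) * (a i \<bullet> u j))))"
      by (simp add: \<theta>_def sum_subtractf sum_distrib_left)
    also have "\<dots> \<le> (\<Sum>j\<in>UNIV. \<rho> x * (w j \<bullet> (S *v w j)))" by (intro sum_mono dir)
    also have "\<dots> = \<rho> x * (\<Sum>j\<in>UNIV. w j \<bullet> (S *v w j))" by (simp add: sum_distrib_left)
    also have "\<dots> \<le> \<rho> x * r"
      using w_sum s0 unfolding r_def \<rho>_def by (intro mult_left_mono sum_nonneg) auto
    finally show ?thesis using comp by (simp add: algebra_simps)
  qed
  obtain B where B: "B \<subseteq> K" "pairwise orthogonal B" "\<And>x. x \<in> B \<Longrightarrow> norm x = 1"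
    "independent B" "card B = dim K"
    using orthonormal_basis_subspace[OF K] by metis
  have finB: "finite B" using B(4) independent_imp_finite by blast
  \<comment> \<open>\<open>C\<close> is the weight carried by the components \<open>c i\<close>
    orthogonal to \<open>V\<close>. It enlarges the bound on the sum of the \<open>s i\<close>, but
    is subtracted again when \<open>\<rho>\<close> is summed over \<open>B\<close>.\<close>
  define C where "C = (\<Sum>i=1..N. s i * (norm (c i))\<^sup>2)"
  have C0: "0 \<le> C" unfolding C_def using s0 by (intro sum_nonneg) simp
  have "(\<Sum>i=1..N. s i)
      = (\<Sum>i=1..N. (\<Sum>j\<in>UNIV. (a i \<bullet> u j)\<^sup>2) + (\<Sum>k=1..N. (c i \<bullet> c k)\<^sup>2 * s k))"
    by (intro sum.cong refl s_eq)
  also have "\<dots> = (\<Sum>i=1..N. \<Sum>j\<in>UNIV. (a i \<bullet> u j)\<^sup>2)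
      + (\<Sum>i=1..N. \<Sum>k=1..N. (c i \<bullet> c k)\<^sup>2 * s k)"
    by (rule sum.distrib)
  also have "\<dots> = (\<Sum>j\<in>UNIV. \<Sum>i=1..N. (a i \<bullet> u j)\<^sup>2)
      + (\<Sum>k=1..N. \<Sum>i=1..N. (c i \<bullet> c k)\<^sup>2 * s k)"
    by (intro arg_cong2[where f = "(+)"] sum.swap)
  also have "\<dots> \<le> \<theta> + (\<Sum>k=1..N. (norm (c k))\<^sup>2 * s k)"
    unfolding \<theta>_def sum_distrib_right[symmetric]
    by (intro add_mono sum_mono frame mult_right_mono cframe s0)
  finally have s_sum: "(\<Sum>i=1..N. s i) \<le> \<theta> + C" by (simp add: C_def mult.commute)
  \<comment> \<open>\<open>c i\<close> is orthogonal to \<open>B\<close>, so Bessel's inequality can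
    be applied to \<open>a i - c i\<close>, whose norm follows from Pythagoras.\<close>
  have proj: "(\<Sum>x\<in>B. (a i \<bullet> x)\<^sup>2) \<le> (1 - \<eta>) - (norm (c i))\<^sup>2" if i: "i \<in> {1..N}" for i
  proof -
    have "c i \<bullet> x = 0" if "x \<in> B" for x
      using that B(1) QV[of x] symQ[of "a i" x] by (auto simp: c_def K_def)
    then have "(\<Sum>x\<in>B. (a i \<bullet> x)\<^sup>2) = (\<Sum>x\<in>B. ((a i - c i) \<bullet> x)\<^sup>2)"
      by (intro sum.cong refl) (simp add: inner_diff_left)
    also have "\<dots> \<le> (norm (a i - c i))\<^sup>2" by (rule bessel_finite[OF finB B(2,3)])
    also have "\<dots> = (norm (a i))\<^sup>2 - (norm (c i))\<^sup>2"
      using symQ[of "a i" "c i"]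
      by (simp add: power2_norm_eq_inner inner_diff_left inner_diff_right c_def QQv inner_commute)
    finally show ?thesis using small[OF i] by simp
  qed
  have "(\<Sum>x\<in>B. \<rho> x) = (\<Sum>i=1..N. s i * (\<Sum>x\<in>B. (a i \<bullet> x)\<^sup>2))"
    unfolding \<rho>_def by (subst sum.swap) (simp add: sum_distrib_left mult.commute)
  also have "\<dots> \<le> (\<Sum>i=1..N. s i * ((1 - \<eta>) - (norm (c i))\<^sup>2))"
    by (intro sum_mono mult_left_mono proj s0)
  also have "\<dots> = (1 - \<eta>) * (\<Sum>i=1..N. s i) - C"
    by (simp add: C_def right_diff_distrib sum_subtractf sum_distrib_left mult.commute)
  also have "\<dots> \<le> (1 - \<eta>) * (\<theta> + C) - C"
    using s_sum \<eta> by (intro diff_right_mono mult_left_mono) auto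
  also have "\<dots> \<le> (1 - \<eta>) * \<theta>" using C0 \<eta> by (simp add: algebra_simps)
  finally have \<rho>_sum: "(\<Sum>x\<in>B. \<rho> x) \<le> (1 - \<eta>) * \<theta>" .
  have r0: "0 \<le> r" by (simp add: r_def)
  have "real (dim K) * \<theta> = (\<Sum>x\<in>B. \<theta>)" by (simp add: B(5))
  also have "\<dots> \<le> (\<Sum>x\<in>B. (r + 2) * \<rho> x)" using B(1,3) by (intro sum_mono key) auto
  also have "\<dots> = (r + 2) * (\<Sum>x\<in>B. \<rho> x)" by (simp add: sum_distrib_left)
  also have "\<dots> \<le> (r + 2) * ((1 - \<eta>) * \<theta>)" using r0 by (intro mult_left_mono \<rho>_sum) simp
  finally have le: "(real (dim K) - (1 - \<eta>) * (r + 2)) * \<theta> \<le> 0" by (simp add: algebra_simps)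
  have "real (dim T) = real (dim U) - real CARD('k)" using dimT by simp
  moreover have "real (dim K) \<ge> real CARD('k) - real CARD('l)" using dimK dimA by simp
  ultimately have "real (dim K) - (1 - \<eta>) * (r + 2) > 0" using gap by (simp add: r_def)
  with le \<theta>0 have "\<theta> = 0" by (simp add: mult_le_0_iff)
  then have u0: "u j = 0" for j
    unfolding \<theta>_def by (simp add: sum_nonneg_eq_0_iff)
  \<comment> \<open>With every \<open>u j\<close> zero, the decomposition exhibits \<open>S\<close>
    as a fixed point of a strict contraction.\<close>
  have "S = Gamma_op N c S"
    by (rule matrix_eq_bilinear, unfold Gamma_op_quad s_c) (simp add: dec u0)
  then show ?thesis
    using Gamma_op_fixpoint_zero[OF cframe csmall] \<eta> by simp
qed

section \<open>Reduction from the ambient space to \<open>U\<close>\<close>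

lemma frame_of_loewner_le:
  assumes U: "subspace U" and le: "(\<Sum>i=1..N. outer (a i)) \<preceq> orth_proj U"
  shows "(\<Sum>i=1..N. (a i \<bullet> w)\<^sup>2) \<le> (norm w)\<^sup>2"
proof -
  note P = orth_proj[OF U]
  have "0 \<le> w \<bullet> ((orth_proj U - (\<Sum>i=1..N. outer (a i))) *v w)"
    using le by (simp only: loewner_le_def psd_def)
  then have "(\<Sum>i=1..N. (a i \<bullet> w)\<^sup>2) \<le> w \<bullet> (orth_proj U *v w)"
    using quad_sum_outer[of w "\<lambda>_. 1" a "{1..N}" w]
    by (simp add: matrix_vector_mult_diff_rdistrib inner_diff_right power2_eq_square)
  also have "\<dots> = (norm (orth_proj U *v w))\<^sup>2"
    using inner_symmetric_matrix[OF P(1), of w "orth_proj U *v w"]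
    by (simp add: power2_norm_eq_inner matrix_vector_mul_assoc P(2))
  also have "\<dots> \<le> (norm w)\<^sup>2"
    by (rule frame_compress(1)[OF P(1,2), where I = "{}"]) simp
  finally show ?thesis .
qed

lemma compress_mem_sym_mats_on:
  assumes U: "subspace U" and A: "transpose A = A"
  shows "orth_proj U ** A ** orth_proj U \<in> sym_mats_on U"
proof -
  define P where "P = orth_proj U"
  note P = orth_proj[OF U, folded P_def]
  have "P ** (P ** A ** P) ** P = P ** A ** P" by (metis P(2) matrix_mul_assoc)
  moreover have "transpose (P ** A ** P) = P ** A ** P"
    by (simp only: matrix_transpose_mul P(1) A matrix_mul_assoc)
  ultimately show ?thesis by (simp add: sym_mats_on_def sym_mats_def flip: P_def)
qed

lemma frob_compress:
  assumes P: "transpose P = P" and M: "P ** M ** P = M"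
  shows "frob (P ** X ** P) M = frob X M"
proof -
  have "frob (P ** X ** P) M = trace (P ** (transpose X ** P ** M))"
    by (simp only: frob_def matrix_transpose_mul P matrix_mul_assoc)
  also have "\<dots> = trace ((transpose X ** P ** M) ** P)" by (rule trace_mul_sym)
  also have "(transpose X ** P ** M) ** P = transpose X ** (P ** M ** P)"
    by (simp only: matrix_mul_assoc)
  finally show ?thesis by (simp only: frob_def M)
qed

lemma critical_point_residual_zero:
  fixes U :: "(real ^ 'n) set" and Z :: "real ^ 'k ^ 'n" and Zs :: "real ^ 'l ^ 'n"
  assumes U: "subspace U" and L: "linear_spd_on U L" and inv: "structured_inverse U L \<eta>"
    and gap: "CARD('k) \<ge> dim U \<or> real CARD('k) - real CARD('l)
        > (1 - \<eta>) * (min (real CARD('l)) (real (dim U) - real CARD('k)) + 2)"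
    and crit: "second_order_critical (extend_op U L) Zs Z"
  shows "extend_op U L (gram Zs - gram Z) = 0"
proof -
  define P where "P = orth_proj U"
  define S where "S = extend_op U L (gram Zs - gram Z)"
  define W where "W = P ** Z"
  define Ws where "Ws = P ** Zs"
  note P = orth_proj[OF U, folded P_def]
  have Pv: "P *v (P *v v) = P *v v" for v by (simp add: matrix_vector_mul_assoc P)
  have PU: "P *v v = v" if "v \<in> U" for v using that P(3) Pv by (metis rangeE)
  have mem: "X \<in> sym_mats_on U \<longleftrightarrow> transpose X = X \<and> P ** X ** P = X" for X
    by (auto simp: sym_mats_on_def sym_mats_def P_def)
  have lin: "linear (\<lambda>X. P ** X ** P)" by (rule linear_conj)
  have bij: "bij_betw L (sym_mats_on U) (sym_mats_on U)" by (rule linear_spd_on_bij[OF U L])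
  obtain N a where \<eta>: "0 < \<eta>" "\<eta> \<le> 1" and a: "\<And>i. i \<in> {1..N} \<Longrightarrow> a i \<in> U"
    and le: "(\<Sum>i=1..N. outer (a i)) \<preceq> orth_proj U"
    and small: "\<And>i. i \<in> {1..N} \<Longrightarrow> (norm (a i))\<^sup>2 \<le> 1 - \<eta>"
    and Linv: "\<And>X. X \<in> sym_mats_on U \<Longrightarrow> inv_into (sym_mats_on U) L X = X - Gamma_op N a X"
    using inv unfolding structured_inverse_def by blast
  note frame = frame_of_loewner_le[OF U le]
  have L_inv: "L (X - Gamma_op N a X) = X" if "X \<in> sym_mats_on U" for X
    using Linv[OF that] bij_betw_inv_into_right[OF bij that] by simp
  have inv_L: "L X - Gamma_op N a (L X) = X" if X: "X \<in> sym_mats_on U" for X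
    using Linv[of "L X"] bij_betw_inv_into_left[OF bij X] bij_betwE[OF bij] X by simp
  have conj_gram: "P ** gram A ** P = gram (P ** A)" for A :: "real ^ 'm ^ 'n"
    by (simp only: gram_def matrix_transpose_mul P(1) matrix_mul_assoc)
  have conj_diff: "P ** (gram Zs - gram Z) ** P = gram Ws - gram W"
    using linear_diff[OF lin, of "gram Zs" "gram Z"] by (simp add: conj_gram W_def Ws_def)
  have gram_mem: "gram Ws - gram W \<in> sym_mats_on U"
    unfolding conj_diff[symmetric] P_def
    by (rule compress_mem_sym_mats_on[OF U]) (simp add: transpose_minus)
  have S_L: "S = L (gram Ws - gram W)"
    by (simp only: S_def extend_op_def conj_diff flip: P_def)
  have S: "S \<in> sym_mats_on U" unfolding S_L using bij_betwE[OF bij] gram_mem by blast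
  have res: "gram Ws - gram W = S - Gamma_op N a S"
    unfolding S_L by (rule inv_L[OF gram_mem, symmetric])
  have St: "transpose S = S" and PSP: "P ** S ** P = S" using S by (simp_all add: mem)
  have SP: "S ** P = S" using PSP P(2) by (metis matrix_mul_assoc)
  have SPv: "S *v (P *v v) = S *v v" for v by (simp add: matrix_vector_mul_assoc SP)
  have SZ: "S ** Z = 0"
    using crit unfolding second_order_critical_def first_order_critical_def S_def by blast
  have SW: "S ** W = 0" by (simp add: W_def matrix_mul_assoc SP SZ)
  have soc: "frob (gram D) S \<le> 1 / 2 * frob (Z ** transpose D + D ** transpose Z)
      (L (P ** (Z ** transpose D + D ** transpose Z) ** P))" for D
  proof -
    have "0 \<le> - frob (gram D) S + 1 / 2 * frob (Z ** transpose D + D ** transpose Z)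
        (extend_op U L (Z ** transpose D + D ** transpose Z))"
      using crit by (simp add: second_order_critical_def Let_def S_def)
    then show ?thesis by (simp add: extend_op_def P_def)
  qed
  have conj_tangent: "P ** (Z ** transpose D + D ** transpose Z) ** P
      = W ** transpose (P ** D) + (P ** D) ** transpose W" for D
    using linear_add[OF lin, of "Z ** transpose D" "D ** transpose Z"]
    by (simp only: W_def matrix_transpose_mul P(1) matrix_mul_assoc)
  have WU: "range ((*v) W) \<subseteq> U"
    using P(3) by (auto simp: W_def simp flip: matrix_vector_mul_assoc)
  note psd = critical_residual_psd[OF St SW res frame small \<eta>]
  have "S = 0"
  proof (cases "inj ((*v) W)")
    case False
    then obtain v where v: "v \<noteq> 0" "W *v v = 0"
      using linear_injective_0[OF matrix_vector_mul_linear, of W] by auto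
    have "x \<bullet> (S *v x) = 0" for x
    proof -
      \<comment> \<open>D = x v^T has zero compressed velocity because W v = 0, while its Gram
        matrix is |v|^2 x x^T. Second-order criticality then forces x^T S x <= 0.\<close>
      define D :: "real ^ 'k ^ 'n" where "D = (\<chi> i j. x $ i * v $ j)"
      have "(W ** transpose D) $ i $ j = (W *v v) $ i * x $ j" for i j
        by (simp add: D_def matrix_matrix_mult_def matrix_vector_mult_def transpose_def
            sum_distrib_left mult_ac)
      then have WD: "W ** transpose D = 0" by (simp add: v(2) vec_eq_iff)
      have "D ** transpose W = transpose (W ** transpose D)" by (simp add: matrix_transpose_mul)
      then have DW: "D ** transpose W = 0" by (simp only: WD transpose_zero)
      have "P ** (Z ** transpose D + D ** transpose Z) ** P
          = (W ** transpose D) ** P + P ** (D ** transpose W)"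
        unfolding conj_tangent by (simp only: matrix_transpose_mul P(1) matrix_mul_assoc)
      also have "\<dots> = 0"
        unfolding WD DW by (simp add: matrix_matrix_mult_def vec_eq_iff)
      finally have 0: "P ** (Z ** transpose D + D ** transpose Z) ** P = 0" .
      have "0 \<in> sym_mats_on U" using linear_0[OF lin] by (simp add: mem)
      then have "L (0 *\<^sub>R 0) = 0 *\<^sub>R L 0" using L unfolding linear_spd_on_def by blast
      then have "frob (gram D) S \<le> 0" using soc[of D] by (simp add: 0 frob_eq_inner)
      moreover have "gram D = (v \<bullet> v) *\<^sub>R outer x"
        by (simp add: gram_def D_def matrix_matrix_mult_def transpose_def outer_def inner_vec_def
            vec_eq_iff sum_distrib_left sum_distrib_right mult_ac)
      ultimately have "(v \<bullet> v) * (x \<bullet> (S *v x)) \<le> 0"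
        by (simp add: frob_eq_inner inner_commute[of _ S] inner_outer)
      moreover have "v \<bullet> v > 0" using v(1) by simp
      ultimately show ?thesis using psd[of x] by (simp add: mult_le_0_iff)
    qed
    then have "y \<bullet> (S *v z) = 0" for y z
      using psd_cauchy_schwarz[OF St psd, of y z] by simp
    then show ?thesis by (intro matrix_eq_bilinear) simp
  next
    case True
    then have rank: "dim (range ((*v) W)) = CARD('k)"
      using dim_image_eq[of "(*v) W" UNIV] by simp
    show ?thesis
    proof (cases "CARD('k) \<ge> dim U")
      case True
      \<comment> \<open>By dimension the injective \<open>W\<close> maps onto \<open>U\<close>, so S
        W = 0 gives S P = 0, and S P = S.\<close>
      then have "range ((*v) W) = U"
        using U WU rank by (intro subspace_dim_equal) (auto simp: linear_subspace_image)
      moreover have "S *v (W *v y) = 0" for y by (simp add: matrix_vector_mul_assoc SW)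
      ultimately have "S *v (P *v y) = 0" for y using P(3) by (metis rangeE rangeI)
      then show ?thesis unfolding matrix_eq by (simp add: SPv)
    next
      case False
      show ?thesis
      proof (rule second_order_full_rank_residual_zero[OF U WU rank a frame small \<eta> S SW res])
        show "(1 - \<eta>) * (min (real CARD('l)) (real (dim U) - real CARD('k)) + 2)
            < real CARD('k) - real CARD('l)"
          using gap False by simp
        show "frob (gram D) S \<le> 1 / 2 * ((X - Gamma_op N a X) \<bullet> X)"
          if D: "orth_proj U ** D = D" and X: "X \<in> sym_mats_on U"
            and tangent: "W ** transpose D + D ** transpose W = X - Gamma_op N a X" for D X
        proof -
          have eq: "P ** (Z ** transpose D + D ** transpose Z) ** P = X - Gamma_op N a X"
            using tangent D[folded P_def] by (simp only: conj_tangent)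
          \<comment> \<open>The ambient velocity agrees with X - Gamma X only after compression;
            since \<open>X\<close> is supported on \<open>U\<close>, the pairing is the
            same.\<close>
          have "frob (Z ** transpose D + D ** transpose Z) X = frob (X - Gamma_op N a X) X"
            using frob_compress[OF P(1), of X "Z ** transpose D + D ** transpose Z"] X by (simp add: eq mem)
          then show ?thesis using soc[of D] by (simp add: eq L_inv[OF X] frob_eq_inner)
        qed
      qed
    qed
  qed
  then show ?thesis by (simp add: S_def)
qed

section \<open>Global optimality from a vanishing residual\<close>

lemma objective_nonneg:
  assumes U: "subspace U" and L: "linear_spd_on U L"
  shows "0 \<le> objective (extend_op U L) Zs Z"
proof -
  define P where "P = orth_proj U"
  define X where "X = P ** (gram Z - gram Zs) ** P"
  have X: "X \<in> sym_mats_on U"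
    unfolding X_def P_def by (rule compress_mem_sym_mats_on[OF U]) (simp add: transpose_minus)
  then have LX: "P ** L X ** P = L X" using L by (simp add: linear_spd_on_def sym_mats_on_def P_def)
  have "objective (extend_op U L) Zs Z = frob X (L X)"
    using frob_compress[OF orth_proj(1)[OF U, folded P_def] LX, of "gram Z - gram Zs"]
    by (simp only: objective_def extend_op_def X_def P_def)
  also have "\<dots> \<ge> 0"
    using L X unfolding linear_spd_on_def
    by (cases "X = 0") (auto simp: frob_eq_inner less_imp_le)
  finally show ?thesis .
qed

text \<open>The residual and the objective use opposite signs of the difference of Gram matrices;
  oddness of \<open>L\<close> on Sym(U) bridges them.\<close>

lemma objective_zero_if_residual_zero:
  assumes U: "subspace U" and L: "linear_spd_on U L"
    and zero: "extend_op U L (gram Zs - gram Z) = 0"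
  shows "objective (extend_op U L) Zs Z = 0"
proof -
  define X where "X = orth_proj U ** (gram Zs - gram Z) ** orth_proj U"
  have "X \<in> sym_mats_on U"
    unfolding X_def by (rule compress_mem_sym_mats_on[OF U]) (simp add: transpose_minus)
  then have "L ((- 1) *\<^sub>R X) = (- 1) *\<^sub>R L X" using L unfolding linear_spd_on_def by blast
  then have "L (- X) = 0" using zero by (simp add: extend_op_def X_def)
  moreover have "orth_proj U ** (gram Z - gram Zs) ** orth_proj U = - X"
    using linear_neg[OF linear_conj, of "orth_proj U" "gram Zs - gram Z" "orth_proj U"]
    by (simp add: X_def)
  ultimately show ?thesis by (simp add: objective_def extend_op_def frob_eq_inner)
qed

theorem theorem4p6:
  fixes U :: "(real ^ 'n) set"
    and L :: "real ^ 'n ^ 'n \<Rightarrow> real ^ 'n ^ 'n"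
    and \<eta> :: real
    and p :: nat
    and Zs :: "real ^ 'l ^ 'n"
  assumes "subspace U" and "dim U = p"
    and "linear_spd_on U L"
    and "structured_inverse U L \<eta>"
  shows "((CARD('k) \<ge> p \<or>
           CARD('k) < p \<and>
           real CARD('k) - real CARD('l)
             > (1 - \<eta>) * (min (real CARD('l)) (real p - real CARD('k)) + 2))
          \<longrightarrow> (\<forall>Z :: real ^ 'k ^ 'n. second_order_critical (extend_op U L) Zs Z
                 \<longrightarrow> global_minimizer (objective (extend_op U L) Zs) Z)) \<and>
         (CARD('k) \<ge> 2 * (CARD('l) + 1)
          \<longrightarrow> (\<forall>Z :: real ^ 'k ^ 'n. second_order_critical (extend_op U L) Zs Z
                 \<longrightarrow> global_minimizer (objective (extend_op U L) Zs) Z))"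
proof -
  have main: "global_minimizer (objective (extend_op U L) Zs) Z"
    if "CARD('k) \<ge> p \<or> real CARD('k) - real CARD('l)
        > (1 - \<eta>) * (min (real CARD('l)) (real p - real CARD('k)) + 2)"
      and "second_order_critical (extend_op U L) Zs Z" for Z :: "real ^ 'k ^ 'n"
  proof -
    have "objective (extend_op U L) Zs Z = 0"
      by (rule objective_zero_if_residual_zero[OF assms(1,3)
            critical_point_residual_zero[OF assms(1,3,4) that[folded assms(2)]]])
    then show ?thesis by (simp add: global_minimizer_def objective_nonneg[OF assms(1,3)])
  qed
  \<comment> \<open>Positivity of \<open>\<eta>\<close> gives strictness and the minimum is at most
    l, so the left side is below l + 2 <= k - l.\<close>
  have "(1 - \<eta>) * (min (real CARD('l)) (real p - real CARD('k)) + 2) < real CARD('k) - real CARD('l)"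
    if k: "CARD('k) \<ge> 2 * (CARD('l) + 1)" and p: "CARD('k) < p"
  proof -
    have \<eta>: "0 < \<eta>" "\<eta> \<le> 1" using assms(4) by (auto simp: structured_inverse_def)
    let ?m = "min (real CARD('l)) (real p - real CARD('k)) + 2"
    have "0 < ?m" using p by simp
    then have "(1 - \<eta>) * ?m < 1 * ?m" using \<eta> by (intro mult_strict_right_mono) auto
    also have "1 * ?m \<le> real CARD('l) + 2" by simp
    also have "\<dots> \<le> real CARD('k) - real CARD('l)"
    proof -
      have "real (2 * (CARD('l) + 1)) \<le> real CARD('k)" using k by (simp only: of_nat_le_iff)
      then show ?thesis by simp
    qed
    finally show ?thesis .
  qed
  then show ?thesis using main by (meson not_le)
qed

end
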